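(* Let $a\ne0$ be a real number, let $F$ be a nonempty finite set of positive integers, and let $I(F)=\{1,2,\ldots,\max F\}\setminus\{\max F-f: f\in F\}=\{g_1,\ldots,g_m\}$ with $g_i<g_{i+1}$. Let $(c_n^a)_n$ be the Charlier polynomials and $\rho_a$ the Charlier measure. Assume that the $m\times m$ Casorati determinant $$\Omega_F(n)=\det\left(c^{-a}_{g_l}(-n+j-1)\right)_{l,j=1}^m$$ satisfies $\Omega_F(n)\neq0$ for all integers $n\ge0$. Then the measure $$\rho_a^F=\prod_{f\in F}(x-f)\,\rho_a$$ has an associated sequence $(q_n)_{n\ge0}$ of orthogonal polynomials, and these polynomials are eigenfunctions of a difference operator of the form $D=\sum_{l=-r}^rh_l\,\mathfrak{s}_l$, with $h_l$ polynomials and $h_{-r},h_r\ne0$, where $$r=\sum_{f\in F}f-\frac{n_F(n_F-1)}{2}+1$$ and $n_F$ is the number of elements of $F$.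
   Context: Charlier polynomials: for $a\ne 0$ and $n\ge0$, $c_n^a(x)=\frac{1}{n!}\sum_{j=0}^n(-a)^{n-j}\binom{n}{j}\binom{x}{j}j!$. Charlier measure: $\rho_a=\sum_{x=0}^\infty\frac{a^x}{x!}\delta_x$ (possibly signed). Multiplying a measure $\mu$ by a polynomial $s$ means $\langle s\mu,p\rangle=\langle\mu,sp\rangle$ for polynomials $p$. A sequence $(q_n)_{n\ge0}$ with $\deg q_n=n$ is orthogonal with respect to $\mu$ if $\langle\mu,q_nq_k\rangle=0$ for $n\ne k$ and $\langle\mu,q_n^2\rangle\ne0$ for all $n$. Shift operators: $\mathfrak{s}_l(p)(x)=p(x+l)$. The polynomials $(q_n)_n$ are eigenfunctions of $D$ if for each $n\ge 0$ there is a number $\lambda_n$ with $D(q_n)=\lambda_nq_n$. *)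

theory Defs
  imports Complex_Main "HOL-Computational_Algebra.Polynomial" "Jordan_Normal_Form.Determinant"
begin

definition charlier :: "real \<Rightarrow> nat \<Rightarrow> real \<Rightarrow> real" where
  "charlier a n x =
     1 / fact n * (\<Sum>j=0..n. (- a) ^ (n - j) * real (n choose j) * (x gchoose j) * fact j)"

text \<open>A (possibly signed) measure enters only through its pairing with polynomials, so
  it is represented by the functional sending a polynomial to its integral.\<close>

type_synonym poly_measure = "real poly \<Rightarrow> real"

definition dirac :: "real \<Rightarrow> poly_measure" where
  "dirac x p = poly p x"

definition charlier_measure :: "real \<Rightarrow> poly_measure" where
  "charlier_measure a p = (\<Sum>x. a ^ x / fact x * dirac (real x) p)"

definition times_measure :: "real poly \<Rightarrow> poly_measure \<Rightarrow> poly_measure" where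
  "times_measure s \<mu> p = \<mu> (s * p)"

text \<open>The series defining the Charlier measure converges on every polynomial.\<close>

lemma summable_charlier_shifted:
  fixes a c :: real
  shows "summable (\<lambda>x. a ^ x / fact x * poly p (real x + c))"
proof (induction p arbitrary: c)
  case 0
  then show ?case by simp
next
  case (pCons b p)
  have exp: "summable (\<lambda>x. b * (a ^ x / fact x))"
    using summable_exp[of a] by (intro summable_mult) (simp add: field_simps)
  have low: "summable (\<lambda>x. c * (a ^ x / fact x * poly p (real x + c)))"
    by (intro summable_mult pCons.IH)
  have "summable (\<lambda>x. a * (a ^ x / fact x * poly p (real x + (c + 1))))"
    by (intro summable_mult pCons.IH)
  moreover have "a * (a ^ x / fact x * poly p (real x + (c + 1)))
      = a ^ Suc x / fact (Suc x) * real (Suc x) * poly p (real (Suc x) + c)" for x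
  proof -
    have "real x + (c + 1) = real (Suc x) + c"
      by simp
    then have "poly p (real x + (c + 1)) = poly p (real (Suc x) + c)"
      by (rule arg_cong)
    then show ?thesis
      by (simp del: of_nat_Suc)
  qed
  ultimately have "summable (\<lambda>x. a ^ Suc x / fact (Suc x) * real (Suc x) * poly p (real (Suc x) + c))"
    by (simp only:)
  then have high: "summable (\<lambda>x. a ^ x / fact x * real x * poly p (real x + c))"
    by (subst (asm) summable_Suc_iff)
  show ?case
    using summable_add[OF summable_add[OF exp low] high] by (simp add: algebra_simps)
qed

lemma summable_charlier_measure:
  "summable (\<lambda>x. a ^ x / fact x * dirac (real x) p)"
  using summable_charlier_shifted[of a p 0] by (simp add: dirac_def)

definition orthogonal_polys :: "poly_measure \<Rightarrow> (nat \<Rightarrow> real poly) \<Rightarrow> bool" where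
  "orthogonal_polys \<mu> q \<longleftrightarrow>
     (\<forall>n. degree (q n) = n) \<and>
     (\<forall>n k. n \<noteq> k \<longrightarrow> \<mu> (q n * q k) = 0) \<and>
     (\<forall>n. \<mu> ((q n)\<^sup>2) \<noteq> 0)"

definition shift :: "int \<Rightarrow> real poly \<Rightarrow> real poly" where
  "shift l p = pcompose p [:of_int l, 1:]"

definition difference_operator :: "int \<Rightarrow> (int \<Rightarrow> real poly) \<Rightarrow> real poly \<Rightarrow> real poly" where
  "difference_operator r h p = (\<Sum>l=-r..r. h l * shift l p)"

definition eigenfunctions :: "(real poly \<Rightarrow> real poly) \<Rightarrow> (nat \<Rightarrow> real poly) \<Rightarrow> bool" where
  "eigenfunctions D q \<longleftrightarrow> (\<forall>n. \<exists>e::real. D (q n) = smult e (q n))"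

definition I_set :: "nat set \<Rightarrow> nat set" where
  "I_set F = {1..Max F} - {Max F - f |f. f \<in> F}"

text \<open>Rows and columns are counted from 0, so the evaluation point \<open>-n + j - 1\<close>
  of the one-based column \<open>j\<close> becomes \<open>-n + j\<close>; row \<open>l\<close> uses the \<open>l\<close>-th smallest element.\<close>

definition Omega :: "real \<Rightarrow> nat set \<Rightarrow> nat \<Rightarrow> real" where
  "Omega a F n =
     (let m = card (I_set F); g = sorted_list_of_set (I_set F)
      in det (mat m m (\<lambda>(l, j). charlier (- a) (g ! l) (- real n + real j))))"

definition rho_F :: "real \<Rightarrow> nat set \<Rightarrow> poly_measure" where
  "rho_F a F = times_measure (\<Prod>f\<in>F. [:- real f, 1:]) (charlier_measure a)"

text \<open>The division is exact, being of a product of consecutive integers.\<close>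

definition order_F :: "nat set \<Rightarrow> int" where
  "order_F F = (\<Sum>f\<in>F. int f) - (int (card F) * (int (card F) - 1)) div 2 + 1"

end

theory Submission
  imports Defs "HOL-Computational_Algebra.Formal_Power_Series"
begin

text \<open>
  Write \<open>M\<close> for the maximum and \<open>k\<close> for the number of elements of \<open>F\<close>, and let
  \<open>m = M + 1 - k\<close>, which is the number of elements \<open>g\<^sub>0 < g\<^sub>1 < \<dots>\<close> of \<open>I(F)\<close>.
  Everything takes place in the basis \<open>e\<^sub>n(x) = (-1)\<^sup>n c\<^sub>n\<^sup>a(x - M - 1)\<close>, and the orthogonal
  polynomials are \<open>q\<^sub>n = \<Sum>\<^sub>j b\<^sub>j(n) e\<^bsub>n-j\<^esub>\<close> with \<open>0 \<le> j \<le> m\<close>, where the vector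
  \<open>b(n)\<close> spans the kernel of the \<open>m\<close> rows \<open>(R\<^sub>l(n), R\<^sub>l(n-1), \<dots>, R\<^sub>l(n-m))\<close> with
  \<open>R\<^sub>l(n) = c\<^bsub>g\<^sub>l\<^esub>\<^sup>-\<^sup>a(-n-1)\<close>. The hypothesis on \<open>\<Omega>\<^sub>F\<close> makes the first and the last
  entry of \<open>b(n)\<close> nonzero.

  Orthogonality. The moment of \<open>e\<^sub>n\<close> against the falling factorial of degree \<open>i\<close> is, up to
  a factor depending on \<open>i\<close>, the binomial coefficient \<open>i - M - 1\<close> over \<open>n\<close> times \<open>(-1)\<^sup>n\<close>.
  For \<open>i \<le> M\<close> the symmetry of binomial coefficients makes these moments
  \<^emph>\<open>polynomials in\<close> \<open>n\<close>, and the ones that belong to a polynomial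
  \<open>S\<close> vanishing on \<open>F\<close> combine to elements of the span of the \<open>R\<^sub>l\<close>
  (lemma \<open>casorati_span\<close>). So \<open>b(n)\<close> annihilates them. What survives is a boundary
  term that is present only when \<open>S\<close> has degree \<open>k + n\<close>, that is, when \<open>q\<^sub>n\<close> is paired with
  a polynomial of degree exactly \<open>n\<close>, and this term is a nonzero multiple of the last
  entry of \<open>b(n)\<close> (lemma \<open>moment_cas_poly\<close>).

  The difference operator. In the basis \<open>e\<close> the second order Charlier operator \<open>N\<close> is
  multiplication by \<open>n\<close>, and the backward shift \<open>\<S>\<close> sends \<open>e\<^sub>n\<close> to \<open>e\<^sub>0 + \<dots> + e\<^sub>n\<close>. Hence
  \<open>\<S> R\<^sub>l(N) q\<^sub>n\<close> has as coefficients the partial sums of the relation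
  \<open>\<Sum>\<^sub>j b\<^sub>j(n) R\<^sub>l(n-j) = 0\<close>. For suitable polynomials \<open>P\<^sub>l\<close>, made of cofactors of the
  Casorati matrix, the operator \<open>\<Sum>\<^sub>l P\<^sub>l(N) \<S> R\<^sub>l(N)\<close> multiplies the coefficient
  \<open>b\<^sub>h(n)\<close> by \<open>\<Lambda>(n-h+m) - \<Lambda>(n)\<close>, where \<open>\<Lambda>(x) - \<Lambda>(x-1)\<close> is the Casorati
  determinant (lemma \<open>multiplier_partial_sum\<close>). Subtracting it from \<open>\<Lambda>(N+m)\<close> leaves an
  operator with \<open>q\<^sub>n\<close> as eigenfunction for the eigenvalue \<open>\<Lambda>(n)\<close>.

  The order. The Casorati determinant has degree exactly
  \<open>\<Sum>\<^sub>l g\<^sub>l - m(m-1)/2 = r - 1\<close>, so \<open>\<Lambda>\<close> has degree \<open>r\<close> and \<open>\<Lambda>(N+m)\<close> is a combination of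
  the shifts by \<open>-r, \<dots>, r\<close>. The polynomials \<open>P\<^sub>l\<close> satisfy \<open>deg P\<^sub>l + g\<^sub>l \<le> r - 1\<close>, because they
  are sums of iterated differences of cofactors. The subtracted part therefore does not
  reach the shift by \<open>r\<close>, and at the shift by \<open>-r\<close> its coefficient has degree less than
  \<open>r\<close>, too small to cancel the coefficient coming from \<open>\<Lambda>(N+m)\<close>.
\<close>

section \<open>Degree bounds indexed by integers\<close>

text \<open>Integer bounds keep the bookkeeping of differences and cofactors free of truncated
  subtraction: a negative bound forces the polynomial to vanish.\<close>

definition deg_le :: "real poly \<Rightarrow> int \<Rightarrow> bool" where
  "deg_le p d \<longleftrightarrow> (\<forall>k. d < int k \<longrightarrow> coeff p k = 0)"

text \<open>The coefficient at the bound of \<open>deg_le\<close>: a leading coefficient that is allowed to be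
  zero, and hence is additive and multiplicative.\<close>

definition icoeff :: "real poly \<Rightarrow> int \<Rightarrow> real" where
  "icoeff p d = (if d < 0 then 0 else coeff p (nat d))"

lemma deg_le_0 [simp]: "deg_le 0 d"
  by (simp add: deg_le_def)

lemma icoeff_0 [simp]: "icoeff 0 d = 0"
  by (simp add: icoeff_def)

lemma deg_le_mono: "deg_le p d \<Longrightarrow> d \<le> e \<Longrightarrow> deg_le p e"
  by (simp add: deg_le_def)

lemma deg_le_neg: "deg_le p d \<Longrightarrow> d < 0 \<Longrightarrow> p = 0"
  by (simp add: deg_le_def poly_eq_iff)

lemma deg_le_degree: "deg_le p (int (degree p))"
  by (simp add: deg_le_def coeff_eq_0)

lemma degree_le_of_deg_le: "deg_le p (int d) \<Longrightarrow> degree p \<le> d"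
  by (simp add: deg_le_def degree_le)

lemma icoeff_eq_0_above: "deg_le p d \<Longrightarrow> d < e \<Longrightarrow> icoeff p e = 0"
  by (simp add: deg_le_def icoeff_def)

lemma deg_le_add: "deg_le p d \<Longrightarrow> deg_le q d \<Longrightarrow> deg_le (p + q) d"
  by (simp add: deg_le_def)

lemma deg_le_diff: "deg_le p d \<Longrightarrow> deg_le q d \<Longrightarrow> deg_le (p - q) d"
  by (simp add: deg_le_def)

lemma deg_le_smult: "deg_le p d \<Longrightarrow> deg_le (smult c p) d"
  by (simp add: deg_le_def)

lemma deg_le_sum: "(\<And>i. i \<in> I \<Longrightarrow> deg_le (f i) d) \<Longrightarrow> deg_le (\<Sum>i\<in>I. f i) d"
  by (induction I rule: infinite_finite_induct) (auto intro: deg_le_add)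

lemma icoeff_add [simp]: "icoeff (p + q) d = icoeff p d + icoeff q d"
  by (simp add: icoeff_def)

lemma icoeff_diff [simp]: "icoeff (p - q) d = icoeff p d - icoeff q d"
  by (simp add: icoeff_def)

lemma icoeff_smult [simp]: "icoeff (smult c p) d = c * icoeff p d"
  by (simp add: icoeff_def)

lemma icoeff_sum: "icoeff (\<Sum>i\<in>I. f i) d = (\<Sum>i\<in>I. icoeff (f i) d)"
  by (induction I rule: infinite_finite_induct) auto

lemma deg_le_mult:
  assumes "deg_le p d" and "deg_le q e"
  shows "deg_le (p * q) (d + e)"
  unfolding deg_le_def
proof (intro allI impI)
  fix k :: nat
  assume k: "d + e < int k"
  have "coeff p i * coeff q (k - i) = 0" if "i \<le> k" for i
  proof (cases "d < int i")
    case True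
    then show ?thesis using assms(1) by (simp add: deg_le_def)
  next
    case False
    then have "e < int (k - i)" using k that by linarith
    then show ?thesis using assms(2) by (simp add: deg_le_def)
  qed
  then show "coeff (p * q) k = 0"
    unfolding coeff_mult by (intro sum.neutral) auto
qed

lemma icoeff_mult:
  assumes p: "deg_le p d" and q: "deg_le q e"
  shows "icoeff (p * q) (d + e) = icoeff p d * icoeff q e"
proof (cases "d < 0 \<or> e < 0")
  case True
  then show ?thesis using deg_le_neg[OF p] deg_le_neg[OF q] by auto
next
  case False
  define m n where "m = nat d" and "n = nat e"
  have d: "d = int m" and e: "e = int n" using False by (simp_all add: m_def n_def)
  have "coeff p i * coeff q (m + n - i) = 0" if "i \<le> m + n" "i \<noteq> m" for i
  proof (cases "m < i")
    case True
    then show ?thesis using p by (simp add: deg_le_def d)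
  next
    case False
    then have "n < m + n - i" using that by linarith
    then show ?thesis using q by (simp add: deg_le_def e)
  qed
  then have "coeff (p * q) (m + n) = (\<Sum>i\<in>{m}. coeff p i * coeff q (m + n - i))"
    unfolding coeff_mult by (intro sum.mono_neutral_right) auto
  moreover have "nat (int m + int n) = m + n" by linarith
  ultimately show ?thesis by (simp add: icoeff_def d e)
qed

lemma deg_le_prod:
  assumes "\<And>i. i \<in> I \<Longrightarrow> deg_le (f i) (d i)"
  shows "deg_le (\<Prod>i\<in>I. f i) (\<Sum>i\<in>I. d i) \<and>
         icoeff (\<Prod>i\<in>I. f i) (\<Sum>i\<in>I. d i) = (\<Prod>i\<in>I. icoeff (f i) (d i))"
  using assms
proof (induction I rule: infinite_finite_induct)
  case (insert i I)
  then have IH: "deg_le (prod f I) (sum d I)"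
      "icoeff (prod f I) (sum d I) = (\<Prod>i\<in>I. icoeff (f i) (d i))"
    and i: "deg_le (f i) (d i)" by auto
  show ?case
    using insert.hyps deg_le_mult[OF i IH(1)] icoeff_mult[OF i IH(1)] IH(2) by simp
qed (auto simp: deg_le_def icoeff_def)

section \<open>Shifts and iterated differences\<close>

lemma poly_shift [simp]: "poly (shift l p) x = poly p (x + of_int l)"
  by (simp add: shift_def poly_pcompose add.commute)

lemma real_poly_eqI:
  fixes p q :: "real poly"
  shows "(\<And>x. poly p x = poly q x) \<Longrightarrow> p = q"
  by (simp add: poly_eq_poly_eq_iff[symmetric] fun_eq_iff)

lemma shift_0 [simp]: "shift 0 p = p"
  by (rule real_poly_eqI) simp

lemma shift_shift: "shift l (shift k p) = shift (l + k) p"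
  by (rule real_poly_eqI) (simp add: algebra_simps)

lemma shift_add: "shift l (p + q) = shift l p + shift l q"
  by (rule real_poly_eqI) simp

lemma shift_mult: "shift l (p * q) = shift l p * shift l q"
  by (rule real_poly_eqI) simp

lemma shift_smult: "shift l (smult c p) = smult c (shift l p)"
  by (rule real_poly_eqI) simp

lemma shift_sum: "shift l (\<Sum>i\<in>I. f i) = (\<Sum>i\<in>I. shift l (f i))"
  by (rule real_poly_eqI) (simp add: poly_sum)

lemma shift_zero_poly [simp]: "shift l 0 = 0"
  by (rule real_poly_eqI) simp

lemma shift_eq_0_iff [simp]: "shift l p = 0 \<longleftrightarrow> p = 0"
  using shift_shift[of "- l" l p] by auto

lemma shift_one [simp]: "shift l 1 = 1"
  by (rule real_poly_eqI) simp

lemma deg_le_iff_degree: "deg_le p d \<longleftrightarrow> p = 0 \<or> int (degree p) \<le> d"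
proof
  assume "deg_le p d"
  then show "p = 0 \<or> int (degree p) \<le> d"
    using leading_coeff_0_iff[of p] unfolding deg_le_def by (meson not_le)
next
  assume "p = 0 \<or> int (degree p) \<le> d"
  then show "deg_le p d" using deg_le_mono[OF deg_le_degree] by auto
qed

lemma degree_shift [simp]: "degree (shift l p) = degree p"
  by (simp add: shift_def degree_pcompose)

lemma deg_le_shift: "deg_le p d \<Longrightarrow> deg_le (shift l p) d"
  by (simp add: deg_le_iff_degree)

text \<open>Induction along the Horner scheme: for \<open>x p\<close> the difference is \<open>x\<close> times the difference
  of \<open>p\<close> minus \<open>l\<close> times a shift of \<open>p\<close>, so each factor \<open>x\<close> adds one more copy of
  \<open>- l\<close> times the leading coefficient.\<close>

lemma deg_le_diff_shift_aux:
  "deg_le p d \<Longrightarrow> deg_le (p - shift l p) (d - 1) \<and>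
     icoeff (p - shift l p) (d - 1) = - of_int l * of_int d * icoeff p d"
proof (induction p arbitrary: d)
  case 0
  then show ?case by simp
next
  case (pCons b p)
  have eq: "pCons b p - shift l (pCons b p) = [:0, 1:] * (p - shift l p) - smult (of_int l) (shift l p)"
    by (rule real_poly_eqI) (simp add: algebra_simps)
  have X: "deg_le [:0, 1:] 1" "icoeff [:0, 1:] 1 = 1"
    by (auto simp: deg_le_def icoeff_def coeff_pCons split: nat.splits)
  have p: "deg_le p (d - 1)"
    unfolding deg_le_def
  proof (intro allI impI)
    fix k assume "d - 1 < int k"
    then have "d < int (Suc k)" by simp
    then have "coeff (pCons b p) (Suc k) = 0" using pCons.prems unfolding deg_le_def by blast
    then show "coeff p k = 0" by simp
  qed
  note IH = pCons.IH[OF p]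
  have 1: "deg_le ([:0, 1:] * (p - shift l p)) (d - 1)"
    using deg_le_mult[OF X(1) conjunct1[OF IH]] by simp
  have 2: "icoeff ([:0, 1:] * (p - shift l p)) (d - 1) = - of_int l * of_int (d - 1) * icoeff p (d - 1)"
    using icoeff_mult[OF X(1) conjunct1[OF IH]] IH X(2) by simp
  have 3: "icoeff (shift l p) (d - 1) = icoeff p (d - 1)"
    using icoeff_eq_0_above[of "p - shift l p" "d - 1 - 1" "d - 1"] IH by simp
  have 4: "of_int d * icoeff (pCons b p) d = of_int d * icoeff p (d - 1)"
  proof (cases "d \<ge> 1")
    case True
    then have "nat d = Suc (nat (d - 1))" by linarith
    then show ?thesis using True by (simp add: icoeff_def)
  qed (cases "d = 0"; simp add: icoeff_def)
  have "icoeff (pCons b p - shift l (pCons b p)) (d - 1) = - of_int l * (of_int d * icoeff p (d - 1))"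
    unfolding eq icoeff_diff icoeff_smult 2 3 by (simp add: algebra_simps)
  then have "icoeff (pCons b p - shift l (pCons b p)) (d - 1) = - of_int l * of_int d * icoeff (pCons b p) d"
    by (simp only: mult.assoc 4)
  moreover have "deg_le (pCons b p - shift l (pCons b p)) (d - 1)"
    unfolding eq by (intro deg_le_diff deg_le_smult deg_le_shift 1 p)
  ultimately show ?case by blast
qed

lemmas deg_le_diff_shift = conjunct1[OF deg_le_diff_shift_aux]
lemmas icoeff_diff_shift = conjunct2[OF deg_le_diff_shift_aux]

lemma icoeff_shift:
  assumes "deg_le p d"
  shows "icoeff (shift l p) d = icoeff p d"
  using icoeff_eq_0_above[OF deg_le_diff_shift[OF assms, of l], of d] by simp

text \<open>The \<open>i\<close>-th power of the operator \<open>p \<mapsto> p - shift l p\<close>; the explicit binomial form is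
  the one in which Casorati determinants produce it.\<close>

definition ndiff :: "int \<Rightarrow> nat \<Rightarrow> real poly \<Rightarrow> real poly" where
  "ndiff l i p = (\<Sum>t\<le>i. smult ((- 1) ^ t * of_nat (i choose t)) (shift (l * int t) p))"

text \<open>Pascal's rule splits one difference off an iterated difference.\<close>

lemma alternating_binomial_sum_Suc:
  fixes f :: "nat \<Rightarrow> 'a::comm_ring_1"
  shows "(\<Sum>t\<le>Suc i. (- 1) ^ t * of_nat (Suc i choose t) * f t) =
         (\<Sum>t\<le>i. (- 1) ^ t * of_nat (i choose t) * (f t - f (Suc t)))"
proof -
  have "(\<Sum>t\<le>Suc i. (- 1) ^ t * of_nat (Suc i choose t) * f t) =
      f 0 + (\<Sum>t\<le>i. (- 1) ^ Suc t * of_nat (Suc i choose Suc t) * f (Suc t))"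
    by (subst sum.atMost_Suc_shift) simp
  also have "\<dots> = f 0 + (\<Sum>t\<le>i. (- 1) ^ Suc t * of_nat (i choose Suc t) * f (Suc t))
      - (\<Sum>t\<le>i. (- 1) ^ t * of_nat (i choose t) * f (Suc t))"
    by (simp add: sum.distrib sum_subtractf sum_negf algebra_simps)
  also have "f 0 + (\<Sum>t\<le>i. (- 1) ^ Suc t * of_nat (i choose Suc t) * f (Suc t))
      = (\<Sum>t\<le>Suc i. (- 1) ^ t * of_nat (i choose t) * f t)"
    by (subst sum.atMost_Suc_shift) simp
  also have "\<dots> = (\<Sum>t\<le>i. (- 1) ^ t * of_nat (i choose t) * f t)"
    by (simp add: binomial_eq_0)
  finally show ?thesis
    by (simp add: right_diff_distrib sum_subtractf)
qed

lemma poly_ndiff: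
  "poly (ndiff l i p) x = (\<Sum>t\<le>i. (- 1) ^ t * of_nat (i choose t) * poly p (x + of_int l * of_nat t))"
  by (simp add: ndiff_def poly_sum)

lemma ndiff_Suc: "ndiff l (Suc i) p = ndiff l i (p - shift l p)"
  by (rule real_poly_eqI)
    (simp only: poly_ndiff alternating_binomial_sum_Suc poly_diff poly_shift,
     simp add: algebra_simps)

lemma ndiff_0 [simp]: "ndiff l 0 p = p"
  by (simp add: ndiff_def)

lemma deg_le_ndiff_aux:
  "deg_le p d \<Longrightarrow> deg_le (ndiff l i p) (d - int i) \<and>
     icoeff (ndiff l i p) (d - int i) = (\<Prod>t<i. - of_int l * (of_int d - of_nat t)) * icoeff p d"
proof (induction i arbitrary: p d)
  case (Suc i)
  note IH = Suc.IH[OF deg_le_diff_shift[OF Suc.prems, of l]]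
  have "(\<Prod>t<Suc i. - of_int l * (of_int d - of_nat t)) =
      - of_int l * of_int d * (\<Prod>t<i. - of_int l * (of_int (d - 1) - of_nat t :: real))"
    by (subst prod.lessThan_Suc_shift) (simp add: algebra_simps)
  then have "(\<Prod>t<Suc i. - of_int l * (of_int d - of_nat t)) * icoeff p d =
      (\<Prod>t<i. - of_int l * (of_int (d - 1) - of_nat t)) * icoeff (p - shift l p) (d - 1)"
    unfolding icoeff_diff_shift[OF Suc.prems, of l] by (simp only: ac_simps)
  moreover have "d - 1 - int i = d - int (Suc i)" by simp
  ultimately show ?case
    using IH unfolding ndiff_Suc by (simp only:)
qed simp

lemmas deg_le_ndiff = conjunct1[OF deg_le_ndiff_aux]
lemmas icoeff_ndiff = conjunct2[OF deg_le_ndiff_aux]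

text \<open>If the entry \<open>(i, j)\<close> has degree at most \<open>w\<^sub>i - v\<^sub>j\<close>, every term of the Leibniz formula has
  the same degree bound, since a permutation only rearranges the \<open>v\<^sub>j\<close>. So the determinant
  of the leading coefficients is the leading coefficient of the determinant.\<close>

lemma det_weighted_degree:
  fixes A :: "real poly mat"
  assumes A: "A \<in> carrier_mat n n"
    and deg: "\<And>i j. i < n \<Longrightarrow> j < n \<Longrightarrow> deg_le (A $$ (i, j)) (w i - v j)"
  shows "deg_le (det A) (sum w {0..<n} - sum v {0..<n})"
    and "icoeff (det A) (sum w {0..<n} - sum v {0..<n}) =
         det (mat n n (\<lambda>(i, j). icoeff (A $$ (i, j)) (w i - v j)))"
proof -
  let ?d = "sum w {0..<n} - sum v {0..<n}"
  have summand: "deg_le (\<Prod>i = 0..<n. A $$ (i, \<pi> i)) ?d \<and>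
      icoeff (\<Prod>i = 0..<n. A $$ (i, \<pi> i)) ?d = (\<Prod>i = 0..<n. icoeff (A $$ (i, \<pi> i)) (w i - v (\<pi> i)))"
    if \<pi>: "\<pi> permutes {0..<n}" for \<pi>
  proof -
    have "(\<Sum>i = 0..<n. w i - v (\<pi> i)) = ?d"
      using sum.permute[OF \<pi>, of v] by (simp add: sum_subtractf comp_def)
    moreover have "deg_le (A $$ (i, \<pi> i)) (w i - v (\<pi> i))" if "i \<in> {0..<n}" for i
      using that permutes_in_image[OF \<pi>, of i] by (intro deg) auto
    ultimately show ?thesis
      using deg_le_prod[of "{0..<n}" "\<lambda>i. A $$ (i, \<pi> i)" "\<lambda>i. w i - v (\<pi> i)"] by simp
  qed
  have det: "det A = (\<Sum>\<pi> | \<pi> permutes {0..<n}. smult (of_int (sign \<pi>)) (\<Prod>i = 0..<n. A $$ (i, \<pi> i)))"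
    unfolding det_def'[OF A] by (intro sum.cong) (auto simp: sign_def)
  show "deg_le (det A) ?d"
    unfolding det by (intro deg_le_sum deg_le_smult) (use summand in auto)
  have "det (mat n n (\<lambda>(i, j). icoeff (A $$ (i, j)) (w i - v j))) =
      (\<Sum>\<pi> | \<pi> permutes {0..<n}. of_int (sign \<pi>) * (\<Prod>i = 0..<n. icoeff (A $$ (i, \<pi> i)) (w i - v (\<pi> i))))"
    unfolding det_def'[OF mat_carrier]
    by (intro sum.cong arg_cong2[of _ _ _ _ "(*)"] prod.cong) (auto simp: permutes_in_image)
  also have "\<dots> = icoeff (det A) ?d"
    unfolding det icoeff_sum icoeff_smult
    by (intro sum.cong arg_cong2[of _ _ _ _ "(*)"]) (use summand in auto)
  finally show "icoeff (det A) ?d = det (mat n n (\<lambda>(i, j). icoeff (A $$ (i, j)) (w i - v j)))" ..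
qed

lemma antidifference_exists_bounded:
  "deg_le p (int n - 1) \<Longrightarrow> \<exists>\<Lambda>. \<Lambda> - shift (- 1) \<Lambda> = p"
proof (induction n arbitrary: p)
  case 0
  then have "p = 0" using deg_le_neg by simp
  then show ?case by (intro exI[of _ 0]) simp
next
  case (Suc n)
  \<comment> \<open>its difference has the same leading term as \<open>p\<close>\<close>
  define \<mu> where "\<mu> = monom (icoeff p (int n) / real (Suc n)) (Suc n)"
  have \<mu>: "deg_le \<mu> (int (Suc n))" "icoeff \<mu> (int (Suc n)) = icoeff p (int n) / real (Suc n)"
    by (auto simp: \<mu>_def deg_le_def icoeff_def)
  let ?\<delta> = "\<mu> - shift (- 1) \<mu>"
  have 1: "deg_le ?\<delta> (int n)" "icoeff ?\<delta> (int n) = icoeff p (int n)"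
    using deg_le_diff_shift[OF \<mu>(1), of "- 1"] icoeff_diff_shift[OF \<mu>(1), of "- 1"] \<mu>(2)
    by (auto simp: field_simps)
  have "deg_le (p - ?\<delta>) (int n - 1)"
    unfolding deg_le_def
  proof (intro allI impI)
    fix k assume "int n - 1 < int k"
    then consider "k = n" | "n < k" by linarith
    then show "coeff (p - ?\<delta>) k = 0"
    proof cases
      case 1
      then show ?thesis using \<open>icoeff ?\<delta> (int n) = icoeff p (int n)\<close> by (simp add: icoeff_def)
    next
      case 2
      then show ?thesis using Suc.prems \<open>deg_le ?\<delta> (int n)\<close> unfolding deg_le_def by simp
    qed
  qed
  then obtain \<Lambda> where "\<Lambda> - shift (- 1) \<Lambda> = p - ?\<delta>" using Suc.IH by blast
  moreover have "\<Lambda> + \<mu> - shift (- 1) (\<Lambda> + \<mu>) = (\<Lambda> - shift (- 1) \<Lambda>) + ?\<delta>"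
    by (simp add: shift_add)
  ultimately have "\<Lambda> + \<mu> - shift (- 1) (\<Lambda> + \<mu>) = p" by simp
  then show ?case by blast
qed

lemma antidifference:
  obtains \<Lambda> where "\<Lambda> - shift (- 1) \<Lambda> = p"
  using antidifference_exists_bounded[of p "Suc (degree p)"] deg_le_degree[of p] by auto

lemma degree_antidifference:
  assumes "\<Lambda> - shift (- 1) \<Lambda> = p" and "p \<noteq> 0"
  shows "degree \<Lambda> = Suc (degree p)"
proof -
  have \<Lambda>: "deg_le \<Lambda> (int (degree \<Lambda>))" by (rule deg_le_degree)
  have deg: "deg_le p (int (degree \<Lambda>) - 1)"
    using deg_le_diff_shift[OF \<Lambda>] assms(1) by metis
  then have pos: "degree \<Lambda> > 0" using deg_le_neg[OF deg] assms(2) by fastforce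
  have "icoeff p (int (degree \<Lambda>) - 1) = real (degree \<Lambda>) * lead_coeff \<Lambda>"
    using icoeff_diff_shift[OF \<Lambda>, of "- 1"] assms(1) by (simp add: icoeff_def)
  then have "icoeff p (int (degree \<Lambda>) - 1) \<noteq> 0" using pos by auto
  then have "coeff p (degree \<Lambda> - 1) \<noteq> 0" using pos by (simp add: icoeff_def nat_diff_distrib split: if_splits)
  then have "degree \<Lambda> - 1 \<le> degree p" by (rule le_degree)
  moreover have "degree p \<le> degree \<Lambda> - 1"
    using degree_le_of_deg_le[of p "degree \<Lambda> - 1"] deg pos by (simp add: of_nat_diff)
  ultimately show ?thesis using pos by simp
qed

section \<open>The inverse of a Casorati matrix\<close>

lemma ndiff_diff: "ndiff l i (p - q) = ndiff l i p - ndiff l i q"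
  by (rule real_poly_eqI) (simp add: poly_ndiff right_diff_distrib sum_subtractf)

lemma ndiff_inversion:
  "(\<Sum>i\<le>s. (- 1) ^ i * of_nat (s choose i) * ndiff l i p) = shift (l * int s) p"
proof (induction s arbitrary: p)
  case (Suc s)
  have "ndiff l i p - ndiff l (Suc i) p = ndiff l i (shift l p)" for i
    by (simp add: ndiff_Suc ndiff_diff)
  then have "(\<Sum>i\<le>Suc s. (- 1) ^ i * of_nat (Suc s choose i) * ndiff l i p) = shift (l * int s) (shift l p)"
    by (simp only: alternating_binomial_sum_Suc Suc.IH)
  also have "\<dots> = shift (l * int (Suc s)) p"
    by (simp add: shift_shift algebra_simps)
  finally show ?case .
qed simp

lemma alternating_binomial_convolution:
  "(\<Sum>r\<le>n. (- 1) ^ r * of_nat (n choose r) * of_nat (r choose i)) =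
     (if i = n then (- 1) ^ i else 0 :: 'a::comm_ring_1)"
proof (induction n arbitrary: i)
  case 0
  then show ?case by (cases i) auto
next
  case (Suc n)
  show ?case
  proof (cases i)
    case 0
    then show ?thesis by (subst alternating_binomial_sum_Suc) simp
  next
    case (Suc k)
    have "of_nat (t choose i) - of_nat (Suc t choose i) = - (of_nat (t choose k) :: 'a)" for t
      by (simp add: Suc)
    then have "(\<Sum>r\<le>Suc n. (- 1) ^ r * of_nat (Suc n choose r) * of_nat (r choose i)) =
        - (\<Sum>r\<le>n. (- 1) ^ r * of_nat (n choose r) * (of_nat (r choose k) :: 'a))"
      by (simp only: alternating_binomial_sum_Suc mult_minus_right sum_negf)
    also have "\<dots> = (if i = Suc n then (- 1) ^ i else 0)"
      unfolding Suc.IH by (simp add: Suc)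
    finally show ?thesis .
  qed
qed

text \<open>The signed Pascal matrix passes from shifted values to iterated differences, and it is its
  own inverse.\<close>

definition pascal :: "nat \<Rightarrow> real poly mat" where
  "pascal m = mat m m (\<lambda>(i, r). (- 1) ^ i * of_nat (r choose i))"

text \<open>The Casorati matrix after column operations that replace the shifts of a row by its
  iterated differences. Both have the same determinant up to sign, but degrees can only
  be read off from the differences.\<close>

definition difference_mat :: "(nat \<Rightarrow> real poly) \<Rightarrow> nat \<Rightarrow> real poly mat" where
  "difference_mat R m = mat m m (\<lambda>(l, i). shift (- 1) (ndiff (- 1) i (R l)))"

definition casorati_mat :: "(nat \<Rightarrow> real poly) \<Rightarrow> nat \<Rightarrow> real poly mat" where
  "casorati_mat R m = mat m m (\<lambda>(l, s). shift (- 1 - int s) (R l))"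

text \<open>Up to sign the determinant of \<open>casorati_mat\<close>.\<close>

definition casoratian :: "(nat \<Rightarrow> real poly) \<Rightarrow> nat \<Rightarrow> real poly" where
  "casoratian R m = det (difference_mat R m)"

text \<open>An adjugate of the Casorati matrix, again up to sign. Building it from the adjugate of
  \<open>difference_mat\<close> makes the degrees of its entries accessible.\<close>

definition window_inverse :: "(nat \<Rightarrow> real poly) \<Rightarrow> nat \<Rightarrow> real poly mat" where
  "window_inverse R m = pascal m * adj_mat (difference_mat R m)"

lemma pascal_carrier [simp]: "pascal m \<in> carrier_mat m m"
  by (simp add: pascal_def)

lemma difference_mat_carrier [simp]: "difference_mat R m \<in> carrier_mat m m"
  by (simp add: difference_mat_def)

lemma casorati_mat_carrier [simp]: "casorati_mat R m \<in> carrier_mat m m"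
  by (simp add: casorati_mat_def)

lemmas adj_difference_mat = adj_mat[OF difference_mat_carrier]

lemma window_inverse_carrier [simp]: "window_inverse R m \<in> carrier_mat m m"
  unfolding window_inverse_def by (rule mult_carrier_mat[OF pascal_carrier adj_difference_mat(1)])

lemma index_mult_mat_sum:
  assumes "A \<in> carrier_mat m m" and "B \<in> carrier_mat m m" and "i < m" and "j < m"
  shows "(A * B) $$ (i, j) = (\<Sum>k<m. A $$ (i, k) * B $$ (k, j))"
  using assms by (simp add: scalar_prod_def lessThan_atLeast0)

lemma pascal_involution: "pascal m * pascal m = 1\<^sub>m m"
proof (rule eq_matI)
  fix i j assume "i < dim_row (1\<^sub>m m)" and "j < dim_col (1\<^sub>m m)"
  then have ij: "i < m" "j < m" by simp_all
  have "(pascal m * pascal m) $$ (i, j) =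
      (\<Sum>r<m. (- 1) ^ i * of_nat (r choose i) * ((- 1) ^ r * of_nat (j choose r)))"
    using ij by (subst index_mult_mat_sum[of _ m]) (auto simp: pascal_def)
  also have "\<dots> = (\<Sum>r\<le>j. (- 1) ^ i * of_nat (r choose i) * ((- 1) ^ r * of_nat (j choose r)))"
    using ij by (intro sum.mono_neutral_right) auto
  also have "\<dots> = (- 1) ^ i * (\<Sum>r\<le>j. (- 1) ^ r * of_nat (j choose r) * of_nat (r choose i))"
    by (simp add: sum_distrib_left algebra_simps)
  also have "\<dots> = 1\<^sub>m m $$ (i, j)"
    using ij by (simp add: alternating_binomial_convolution power_mult_distrib[symmetric] flip: power_add)
  finally show "(pascal m * pascal m) $$ (i, j) = 1\<^sub>m m $$ (i, j)" .
qed (auto simp: pascal_def)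

lemma casorati_mat_eq: "casorati_mat R m = difference_mat R m * pascal m"
proof (rule eq_matI)
  fix l s assume "l < dim_row (difference_mat R m * pascal m)" and "s < dim_col (difference_mat R m * pascal m)"
  then have ls: "l < m" "s < m" by (simp_all add: difference_mat_def pascal_def)
  have "(difference_mat R m * pascal m) $$ (l, s) =
      (\<Sum>i<m. shift (- 1) (ndiff (- 1) i (R l)) * ((- 1) ^ i * of_nat (s choose i)))"
    using ls by (subst index_mult_mat_sum[of _ m]) (auto simp: difference_mat_def pascal_def)
  also have "\<dots> = (\<Sum>i\<le>s. shift (- 1) (ndiff (- 1) i (R l)) * ((- 1) ^ i * of_nat (s choose i)))"
    using ls by (intro sum.mono_neutral_right) auto
  also have "\<dots> = shift (- 1) (\<Sum>i\<le>s. (- 1) ^ i * of_nat (s choose i) * ndiff (- 1) i (R l))"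
    by (rule real_poly_eqI) (simp add: poly_sum mult_ac of_nat_poly)
  also have "\<dots> = casorati_mat R m $$ (l, s)"
    using ls by (simp add: ndiff_inversion shift_shift casorati_mat_def)
  finally show "casorati_mat R m $$ (l, s) = (difference_mat R m * pascal m) $$ (l, s)" ..
qed (auto simp: casorati_mat_def difference_mat_def pascal_def)

lemma casorati_mat_mult_window_inverse:
  "casorati_mat R m * window_inverse R m = casoratian R m \<cdot>\<^sub>m 1\<^sub>m m"
proof -
  let ?B = "difference_mat R m" and ?T = "pascal m"
  have "casorati_mat R m * window_inverse R m = ?B * (?T * (?T * adj_mat ?B))"
    unfolding casorati_mat_eq window_inverse_def
    using window_inverse_carrier[of R m] unfolding window_inverse_def
    by (intro assoc_mult_mat[of _ m m _ m _ m]) auto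
  also have "?T * (?T * adj_mat ?B) = (?T * ?T) * adj_mat ?B"
    by (rule assoc_mult_mat[symmetric, of _ m m _ m _ m]) (auto simp: adj_difference_mat(1))
  also have "\<dots> = adj_mat ?B"
    using left_mult_one_mat[OF adj_difference_mat(1)] by (simp add: pascal_involution)
  finally show ?thesis by (simp add: adj_difference_mat(2) casoratian_def)
qed

lemma window_inverse_mult_casorati_mat:
  "window_inverse R m * casorati_mat R m = casoratian R m \<cdot>\<^sub>m 1\<^sub>m m"
proof -
  let ?B = "difference_mat R m" and ?T = "pascal m"
  have adj: "adj_mat ?B \<in> carrier_mat m m" by (rule adj_difference_mat(1))
  have "window_inverse R m * casorati_mat R m = ?T * (adj_mat ?B * (?B * ?T))"
    unfolding casorati_mat_eq window_inverse_def
    using casorati_mat_carrier[of R m] unfolding casorati_mat_eq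
    by (intro assoc_mult_mat[of _ m m _ m _ m]) (auto simp: adj)
  also have "adj_mat ?B * (?B * ?T) = (adj_mat ?B * ?B) * ?T"
    by (rule assoc_mult_mat[symmetric, of _ m m _ m _ m]) (auto simp: adj)
  also have "\<dots> = casoratian R m \<cdot>\<^sub>m ?T"
    by (simp add: adj_difference_mat(3) casoratian_def mult_smult_assoc_mat[of _ m m _ m] left_mult_one_mat[of _ m m])
  also have "?T * (casoratian R m \<cdot>\<^sub>m ?T) = casoratian R m \<cdot>\<^sub>m 1\<^sub>m m"
    by (simp add: mult_smult_distrib[of _ m m _ m] pascal_involution)
  finally show ?thesis .
qed

lemma casorati_window_sum:
  assumes "l < m" and "k < m"
  shows "(\<Sum>r<m. poly (R l) (x - 1 - real r) * poly (window_inverse R m $$ (r, k)) x) =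
         (if l = k then poly (casoratian R m) x else 0)"
proof -
  have "(\<Sum>r<m. casorati_mat R m $$ (l, r) * window_inverse R m $$ (r, k)) = (if l = k then casoratian R m else 0)"
    using index_mult_mat_sum[of "casorati_mat R m" m "window_inverse R m" l k] assms
    by (auto simp: casorati_mat_mult_window_inverse)
  then have "poly (\<Sum>r<m. casorati_mat R m $$ (l, r) * window_inverse R m $$ (r, k)) x = poly (if l = k then casoratian R m else 0) x"
    by (rule arg_cong)
  then show ?thesis using assms by (simp add: poly_sum casorati_mat_def algebra_simps)
qed

lemma window_casorati_sum:
  assumes "r < m" and "s < m"
  shows "(\<Sum>l<m. poly (window_inverse R m $$ (r, l)) x * poly (R l) (x - 1 - real s)) =
         (if r = s then poly (casoratian R m) x else 0)"
proof -
  have "(\<Sum>l<m. window_inverse R m $$ (r, l) * casorati_mat R m $$ (l, s)) = (if r = s then casoratian R m else 0)"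
    using index_mult_mat_sum[of "window_inverse R m" m "casorati_mat R m" r s] assms
    by (auto simp: window_inverse_mult_casorati_mat)
  then have "poly (\<Sum>l<m. window_inverse R m $$ (r, l) * casorati_mat R m $$ (l, s)) x = poly (if r = s then casoratian R m else 0) x"
    by (rule arg_cong)
  then show ?thesis using assms by (simp add: poly_sum casorati_mat_def algebra_simps)
qed

lemma poly_det:
  fixes A :: "real poly mat"
  assumes "A \<in> carrier_mat n n"
  shows "poly (det A) x = det (mat n n (\<lambda>(i, j). poly (A $$ (i, j)) x))"
  unfolding det_def'[OF assms] det_def'[OF mat_carrier] poly_sum
  by (intro sum.cong) (auto simp: poly_prod sign_def permutes_in_image intro!: prod.cong)

lemma casoratian_nonzero:
  assumes "det (mat m m (\<lambda>(l, s). poly (R l) (x - 1 - real s))) \<noteq> 0"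
  shows "poly (casoratian R m) x \<noteq> 0"
proof -
  have "mat m m (\<lambda>(i, j). poly (casorati_mat R m $$ (i, j)) x) = mat m m (\<lambda>(l, s). poly (R l) (x - 1 - real s))"
    by (rule cong_mat) (auto simp: casorati_mat_def algebra_simps)
  then have "poly (det (casorati_mat R m)) x \<noteq> 0"
    using assms by (simp add: poly_det[of _ m])
  moreover have "det (casorati_mat R m) = casoratian R m * det (pascal m)"
    unfolding casorati_mat_eq casoratian_def by (rule det_mult[of _ m]) auto
  ultimately show ?thesis by auto
qed

text \<open>The kernel vector of the \<open>m\<close> rows of length \<open>m + 1\<close>, by Cramer's rule: the entry at \<open>0\<close> is
  prescribed to be the determinant, and the others solve the remaining square system.\<close>

definition cas_coeff :: "(nat \<Rightarrow> real poly) \<Rightarrow> nat \<Rightarrow> real \<Rightarrow> nat \<Rightarrow> real" where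
  "cas_coeff R m x j =
     (if j = 0 then poly (casoratian R m) x
      else if j \<le> m then - (\<Sum>l<m. poly (window_inverse R m $$ (j - 1, l)) x * poly (R l) x)
      else 0)"

lemma cas_coeff_relation:
  assumes l: "l < m"
  shows "(\<Sum>j\<le>m. cas_coeff R m x j * poly (R l) (x - real j)) = 0"
proof -
  have "(\<Sum>j\<le>m. cas_coeff R m x j * poly (R l) (x - real j)) =
      poly (casoratian R m) x * poly (R l) x + (\<Sum>j<m. cas_coeff R m x (Suc j) * poly (R l) (x - 1 - real j))"
    by (simp add: sum.atMost_shift cas_coeff_def algebra_simps)
  also have "(\<Sum>j<m. cas_coeff R m x (Suc j) * poly (R l) (x - 1 - real j)) =
      - (\<Sum>j<m. \<Sum>k<m. poly (R l) (x - 1 - real j) * poly (window_inverse R m $$ (j, k)) x * poly (R k) x)"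
    by (simp add: cas_coeff_def sum_negf sum_distrib_left sum_distrib_right algebra_simps)
  also have "\<dots> = - (\<Sum>k<m. (\<Sum>j<m. poly (R l) (x - 1 - real j) * poly (window_inverse R m $$ (j, k)) x) * poly (R k) x)"
    by (subst sum.swap) (simp add: sum_distrib_right)
  also have "\<dots> = - (\<Sum>k<m. (if l = k then poly (casoratian R m) x else 0) * poly (R k) x)"
    by (simp add: casorati_window_sum[OF l])
  also have "\<dots> = - (poly (casoratian R m) x * poly (R l) x)"
    using l by (simp add: if_distrib[of "\<lambda>t. t * _"] cong: if_cong)
  finally show ?thesis by simp
qed

text \<open>If the last entry were zero, the first \<open>m\<close> entries would be a kernel vector of the Casorati
  matrix at \<open>x + 1\<close>, which is invertible, while the entry at \<open>0\<close> is nonzero.\<close>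

lemma cas_coeff_last_nonzero:
  assumes m: "m > 0" and "poly (casoratian R m) x \<noteq> 0" and "poly (casoratian R m) (x + 1) \<noteq> 0"
  shows "cas_coeff R m x m \<noteq> 0"
proof
  assume last: "cas_coeff R m x m = 0"
  have rel: "(\<Sum>j<m. cas_coeff R m x j * poly (R l) (x - real j)) = 0" if "l < m" for l
    using cas_coeff_relation[OF that, of R x] last by (simp flip: lessThan_Suc_atMost)
  have "0 = (\<Sum>l<m. poly (window_inverse R m $$ (0, l)) (x + 1) *
      (\<Sum>j<m. cas_coeff R m x j * poly (R l) (x - real j)))"
    by (simp add: rel)
  also have "\<dots> = (\<Sum>j<m. cas_coeff R m x j *
      (\<Sum>l<m. poly (window_inverse R m $$ (0, l)) (x + 1) * poly (R l) (x + 1 - 1 - real j)))"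
    by (simp add: sum_distrib_left mult_ac) (rule sum.swap)
  also have "\<dots> = (\<Sum>j<m. cas_coeff R m x j * (if 0 = j then poly (casoratian R m) (x + 1) else 0))"
    by (intro sum.cong) (simp_all only: window_casorati_sum[OF m] lessThan_iff)
  also have "\<dots> = poly (casoratian R m) x * poly (casoratian R m) (x + 1)"
    using m by (simp add: if_distrib[of "\<lambda>t. _ * t"] cas_coeff_def cong: if_cong)
  finally show False using assms by simp
qed

text \<open>The cofactors that omit the point \<open>x\<close> from the windows \<open>{x, \<dots>, x + m - 1}\<close> to
  \<open>{x - m + 1, \<dots>, x}\<close>, summed over all windows of \<open>m\<close> consecutive points that contain \<open>x\<close>.
  Equivalently, the variational derivative of the sum of all Casorati determinants with respect
  to the value of the \<open>l\<close>-th row at \<open>x\<close>.\<close>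

definition multiplier :: "(nat \<Rightarrow> real poly) \<Rightarrow> nat \<Rightarrow> nat \<Rightarrow> real poly" where
  "multiplier R m l = (\<Sum>r<m. shift (1 + int r) (window_inverse R m $$ (r, l)))"

text \<open>Each window contributes separately. The window inverse picks out the term at the point
  \<open>x - h\<close> and kills all other points inside the window. If the window reaches up far enough,
  it contains all points \<open>x, \<dots>, x - h\<close> of the partial sum, and the term with index \<open>h\<close>
  survives. Otherwise the full relation turns the partial sum into the complementary one,
  whose points all lie inside the window and are different from \<open>x - h\<close>, so nothing survives.\<close>

lemma multiplier_partial_sum:
  assumes h: "h \<le> m"
  shows "(\<Sum>l<m. poly (multiplier R m l) (x - real h) * (\<Sum>j\<le>h. cas_coeff R m x j * poly (R l) (x - real j))) =
         cas_coeff R m x h * (\<Sum>r\<in>{h..<m}. poly (casoratian R m) (x - real h + 1 + real r))"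
proof -
  define U where "U l = (\<Sum>j\<le>h. cas_coeff R m x j * poly (R l) (x - real j))" for l
  define V where "V r l = poly (window_inverse R m $$ (r, l)) (x - real h + 1 + real r)" for r l
  have key: "(\<Sum>l<m. V r l * U l) = (if h \<le> r then cas_coeff R m x h * poly (casoratian R m) (x - real h + 1 + real r) else 0)"
    if r: "r < m" for r
  proof -
    let ?y = "x - real h + 1 + real r"
    have entry: "(\<Sum>l<m. V r l * poly (R l) (x - real j)) = (if j = h then poly (casoratian R m) ?y else 0)"
      if "h \<le> r + j" "r + j < h + m" for j
    proof -
      \<comment> \<open>the window at \<open>?y\<close> lists the points \<open>?y - 1 - s\<close> for \<open>s < m\<close>, and \<open>x - h\<close> is the one with \<open>s = r\<close>\<close>
      have "x - real j = ?y - 1 - real (r + j - h)" using that by (simp add: of_nat_diff)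
      then have "(\<Sum>l<m. V r l * poly (R l) (x - real j)) = (if r = r + j - h then poly (casoratian R m) ?y else 0)"
        unfolding V_def using window_casorati_sum[OF r, of "r + j - h" R ?y] that by simp
      then show ?thesis using that by (simp add: eq_diff_iff) (auto simp: le_diff_conv2)
    qed
    show ?thesis
    proof (cases "h \<le> r")
      case True
      have "(\<Sum>l<m. V r l * U l) = (\<Sum>j\<le>h. cas_coeff R m x j * (\<Sum>l<m. V r l * poly (R l) (x - real j)))"
        unfolding U_def by (simp add: sum_distrib_left mult_ac) (rule sum.swap)
      also have "\<dots> = (\<Sum>j\<le>h. cas_coeff R m x j * (if j = h then poly (casoratian R m) ?y else 0))"
        by (intro sum.cong refl arg_cong2[of _ _ _ _ "(*)"] entry) (use True r in auto)
      also have "\<dots> = cas_coeff R m x h * poly (casoratian R m) ?y"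
        by (simp add: if_distrib[of "\<lambda>t. _ * t"] cong: if_cong)
      finally show ?thesis using True by simp
    next
      case False
      have U: "U l = - (\<Sum>j\<in>{h<..m}. cas_coeff R m x j * poly (R l) (x - real j))" if "l < m" for l
      proof -
        have "{..m} = {..h} \<union> {h<..m}" using h by auto
        then have "0 = U l + (\<Sum>j\<in>{h<..m}. cas_coeff R m x j * poly (R l) (x - real j))"
          unfolding U_def cas_coeff_relation[OF that, of R x, symmetric]
          by (simp add: sum.union_disjoint ivl_disj_int)
        then show ?thesis by simp
      qed
      have "(\<Sum>l<m. V r l * U l) = - (\<Sum>l<m. \<Sum>j\<in>{h<..m}. cas_coeff R m x j * (V r l * poly (R l) (x - real j)))"
        by (simp add: U sum_distrib_left sum_negf mult_ac)
      also have "\<dots> = - (\<Sum>j\<in>{h<..m}. cas_coeff R m x j * (\<Sum>l<m. V r l * poly (R l) (x - real j)))"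
        by (subst sum.swap) (simp add: sum_distrib_left)
      also have "\<dots> = - (\<Sum>j\<in>{h<..m}. cas_coeff R m x j * (if j = h then poly (casoratian R m) ?y else 0))"
        by (intro arg_cong[of _ _ uminus] sum.cong refl arg_cong2[of _ _ _ _ "(*)"] entry) (use False in auto)
      also have "\<dots> = 0" by simp
      finally show ?thesis using False by simp
    qed
  qed
  have "(\<Sum>l<m. poly (multiplier R m l) (x - real h) * U l) = (\<Sum>l<m. \<Sum>r<m. V r l * U l)"
    by (simp add: multiplier_def poly_sum V_def sum_distrib_left sum_distrib_right algebra_simps)
  also have "\<dots> = (\<Sum>r<m. if h \<le> r then cas_coeff R m x h * poly (casoratian R m) (x - real h + 1 + real r) else 0)"
    by (subst sum.swap) (simp add: key)
  also have "\<dots> = (\<Sum>r\<in>{h..<m}. cas_coeff R m x h * poly (casoratian R m) (x - real h + 1 + real r))"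
    by (intro sum.mono_neutral_cong_right) auto
  finally show ?thesis by (simp add: U_def sum_distrib_left)
qed

section \<open>The degree of a Casorati determinant\<close>

definition falling :: "nat \<Rightarrow> real poly" where
  "falling i = (\<Prod>t<i. [:- real t, 1:])"

lemma poly_falling: "poly (falling i) x = (\<Prod>t<i. x - real t)"
  by (simp add: falling_def poly_prod)

lemma falling_Suc: "falling (Suc i) = falling i * [:- real i, 1:]"
  by (simp add: falling_def)

lemma falling_0 [simp]: "falling 0 = 1"
  by (simp add: falling_def)

lemma degree_falling [simp]: "degree (falling i) = i"
proof (induction i)
  case (Suc i)
  then have "falling i \<noteq> 0" by (cases i) auto
  then show ?case using Suc by (simp add: falling_Suc degree_mult_eq del: mult_pCons_right)
qed simp

lemma lead_coeff_falling [simp]: "coeff (falling i) i = 1"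
proof -
  have "lead_coeff (falling i) = 1"
    unfolding falling_def by (simp add: lead_coeff_prod)
  then show ?thesis by simp
qed

lemma poly_falling_gbinomial: "poly (falling i) x = fact i * (x gchoose i)"
  by (simp add: poly_falling gbinomial_prod_rev lessThan_atLeast0)

lemma poly_falling_small: "s < i \<Longrightarrow> poly (falling i) (real s) = 0"
  by (auto simp: poly_falling)

lemma poly_falling_diag: "poly (falling i) (real i) \<noteq> 0"
  by (auto simp: poly_falling)

lemma falling_combination_zero:
  assumes "\<And>x. (\<Sum>i<m. v i * poly (falling i) x) = 0" and "i < m"
  shows "v i = 0"
  using assms(2)
proof (induction i rule: less_induct)
  case (less s)
  have "(\<Sum>i<m. v i * poly (falling i) (real s)) = (\<Sum>i\<in>{s}. v i * poly (falling i) (real s))"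
    using less by (intro sum.mono_neutral_right) (auto simp: poly_falling_small, metis nat_neq_iff poly_falling_small)
  then show ?case using assms(1)[of "real s"] poly_falling_diag[of s] by simp
qed

text \<open>A kernel vector is a combination of falling factorials of degree less than \<open>m\<close> with the \<open>m\<close>
  distinct roots \<open>g l\<close>; it is zero, and falling factorials are linearly independent.\<close>

lemma det_falling_factorials_nonzero:
  assumes inj: "inj_on g {..<m}" and c: "\<And>l. l < m \<Longrightarrow> c l \<noteq> 0"
  shows "det (mat m m (\<lambda>(l, i). poly (falling i) (real (g l)) * c l)) \<noteq> 0"
proof
  let ?A = "mat m m (\<lambda>(l, i). poly (falling i) (real (g l)) * c l)"
  assume "det ?A = 0"
  then obtain v where v: "v \<in> carrier_vec m" "v \<noteq> 0\<^sub>v m" "?A *\<^sub>v v = 0\<^sub>v m"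
    using det_0_iff_vec_prod_zero[of ?A m] by auto
  define p where "p = (\<Sum>i<m. smult (v $ i) (falling i))"
  have "poly p (real (g l)) = 0" if l: "l < m" for l
  proof -
    have "0 = (?A *\<^sub>v v) $ l" using v(3) l by simp
    also have "\<dots> = (\<Sum>i<m. poly (falling i) (real (g l)) * c l * v $ i)"
      using l v(1) by (simp add: scalar_prod_def lessThan_atLeast0)
    also have "\<dots> = c l * poly p (real (g l))"
      by (simp add: p_def poly_sum sum_distrib_left mult_ac)
    finally show ?thesis using c[OF l] by simp
  qed
  then have roots: "(\<lambda>l. real (g l)) ` {..<m} \<subseteq> {x. poly p x = 0}" by auto
  have "p = 0"
  proof (rule ccontr)
    assume "p \<noteq> 0"
    have "inj_on (\<lambda>l. real (g l)) {..<m}" using inj by (auto simp: inj_on_def)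
    then have "m = card ((\<lambda>l. real (g l)) ` {..<m})" by (simp add: card_image)
    also have "\<dots> \<le> card {x. poly p x = 0}"
      by (rule card_mono[OF poly_roots_finite[OF \<open>p \<noteq> 0\<close>] roots])
    also have "\<dots> \<le> degree p" by (rule card_poly_roots_bound[OF \<open>p \<noteq> 0\<close>])
    finally have "m \<le> degree p" .
    moreover have "degree p \<le> m - 1"
      unfolding p_def by (rule degree_sum_le) (auto intro: order_trans[OF degree_smult_le])
    moreover have "m > 0" using \<open>p \<noteq> 0\<close> by (auto simp: p_def intro: Nat.gr0I)
    ultimately show False by simp
  qed
  then have "poly p x = 0" for x by simp
  then have "(\<Sum>i<m. v $ i * poly (falling i) x) = 0" for x
    by (simp add: p_def poly_sum)
  then have "v $ i = 0" if "i < m" for i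
    using falling_combination_zero[of "\<lambda>i. v $ i" m] that by blast
  then have "v = 0\<^sub>v m" using v(1) by (intro eq_vecI) auto
  then show False using v(2) by simp
qed

lemma difference_mat_degree:
  assumes deg: "\<And>l. l < m \<Longrightarrow> deg_le (R l) (int (g l))" and "l < m" and "i < m"
  shows "deg_le (difference_mat R m $$ (l, i)) (int (g l) - int i)"
    and "icoeff (difference_mat R m $$ (l, i)) (int (g l) - int i) =
         poly (falling i) (real (g l)) * coeff (R l) (g l)"
  using assms icoeff_shift[OF deg_le_ndiff[OF deg[OF assms(2)]], of "- 1" "- 1" i]
  by (auto simp: difference_mat_def icoeff_ndiff poly_falling icoeff_def[of "R l"]
      intro!: deg_le_shift deg_le_ndiff)

text \<open>The degree that a Casorati determinant of \<open>m\<close> polynomials of degrees \<open>g l\<close> should have: the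
  column of \<open>i\<close>-th differences loses \<open>i\<close> degrees.\<close>

definition casoratian_degree :: "(nat \<Rightarrow> nat) \<Rightarrow> nat \<Rightarrow> int" where
  "casoratian_degree g m = (\<Sum>l<m. int (g l)) - (\<Sum>i<m. int i)"

text \<open>The bound is attained because taking differences turns the leading coefficients into falling
  factorials of the degrees \<open>g l\<close>, whose determinant does not vanish for distinct degrees.\<close>

lemma degree_casoratian:
  assumes deg: "\<And>l. l < m \<Longrightarrow> degree (R l) = g l" and nz: "\<And>l. l < m \<Longrightarrow> R l \<noteq> 0"
    and inj: "inj_on g {..<m}"
  shows "casoratian R m \<noteq> 0" and "int (degree (casoratian R m)) = casoratian_degree g m"
proof -
  have deg': "deg_le (R l) (int (g l))" if "l < m" for l
    using deg_le_degree[of "R l"] deg[OF that] by simp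
  have D: "deg_le (difference_mat R m $$ (l, i)) (int (g l) - int i)"
    "icoeff (difference_mat R m $$ (l, i)) (int (g l) - int i) =
       poly (falling i) (real (g l)) * coeff (R l) (g l)" if "l < m" "i < m" for l i
    using difference_mat_degree[of m R g l i] deg' that by auto
  have le: "deg_le (casoratian R m) (casoratian_degree g m)"
    using det_weighted_degree(1)[OF difference_mat_carrier, of m R "\<lambda>l. int (g l)" int] D(1)
    by (simp add: casoratian_def casoratian_degree_def lessThan_atLeast0)
  have "icoeff (casoratian R m) (casoratian_degree g m) =
      det (mat m m (\<lambda>(l, i). icoeff (difference_mat R m $$ (l, i)) (int (g l) - int i)))"
    using det_weighted_degree(2)[OF difference_mat_carrier, of m R "\<lambda>l. int (g l)" int] D(1)
    by (simp add: casoratian_def casoratian_degree_def lessThan_atLeast0)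
  also have "mat m m (\<lambda>(l, i). icoeff (difference_mat R m $$ (l, i)) (int (g l) - int i)) =
      mat m m (\<lambda>(l, i). poly (falling i) (real (g l)) * coeff (R l) (g l))"
    by (rule cong_mat) (auto simp: D(2))
  also have "det \<dots> \<noteq> 0"
    by (rule det_falling_factorials_nonzero[OF inj]) (use deg nz leading_coeff_0_iff in metis)
  finally have lead: "icoeff (casoratian R m) (casoratian_degree g m) \<noteq> 0" .
  then show "casoratian R m \<noteq> 0" by auto
  then have "int (degree (casoratian R m)) \<le> casoratian_degree g m" using le by (simp add: deg_le_iff_degree)
  moreover have "casoratian_degree g m \<le> int (degree (casoratian R m))"
    using lead icoeff_eq_0_above[OF deg_le_degree[of "casoratian R m"]] by force
  ultimately show "int (degree (casoratian R m)) = casoratian_degree g m" by simp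
qed

lemma sum_insert_index:
  assumes "l < m"
  shows "(\<Sum>i = 0..<m - 1. (f (insert_index l i) :: int)) = (\<Sum>i<m. f i) - f l"
proof -
  obtain n where m: "m = Suc n" using assms by (cases m) auto
  have "(\<Sum>i = 0..<n. f (insert_index l i)) = (\<Sum>i\<in>insert_index l ` {0..<n}. f i)"
    by (simp add: sum.reindex[OF insert_index_inj_on])
  also have "\<dots> = (\<Sum>i\<in>{0..<Suc n} - {l}. f i)"
    using insert_index_image[of l n] assms m by simp
  also have "\<dots> = (\<Sum>i<m. f i) - f l"
    using assms m by (simp add: sum_diff1 lessThan_atLeast0)
  finally show ?thesis by (simp add: m)
qed

text \<open>Deleting row \<open>l\<close> and column \<open>i\<close> removes the weights \<open>g l\<close> and \<open>i\<close> from the total.\<close>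

lemma adj_difference_mat_degree:
  assumes deg: "\<And>l. l < m \<Longrightarrow> deg_le (R l) (int (g l))" and i: "i < m" and l: "l < m"
  shows "deg_le (adj_mat (difference_mat R m) $$ (i, l)) (casoratian_degree g m - int (g l) + int i)"
proof -
  let ?B = "difference_mat R m"
  have dims: "dim_row ?B = m" "dim_col ?B = m" using carrier_matD[OF difference_mat_carrier[of R m]] by auto
  have entry: "deg_le (mat_delete ?B l i $$ (p, q)) (int (g (insert_index l p)) - int (insert_index i q))"
    if "p < m - 1" "q < m - 1" for p q
  proof -
    have "insert_index l p < m" "insert_index i q < m" using that by (auto simp: insert_index_def)
    then have "deg_le (?B $$ (insert_index l p, insert_index i q)) (int (g (insert_index l p)) - int (insert_index i q))"
      using difference_mat_degree(1)[of m R g] deg by blast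
    then show ?thesis
      using that by (simp add: mat_delete_def dims insert_index_def)
  qed
  have "deg_le (det (mat_delete ?B l i))
      ((\<Sum>p = 0..<m - 1. int (g (insert_index l p))) - (\<Sum>q = 0..<m - 1. int (insert_index i q)))"
    by (rule det_weighted_degree(1)[OF _ entry]) (use mat_delete_carrier[OF difference_mat_carrier[of R m]] in auto)
  also have "(\<Sum>p = 0..<m - 1. int (g (insert_index l p))) - (\<Sum>q = 0..<m - 1. int (insert_index i q))
      = casoratian_degree g m - int (g l) + int i"
    using sum_insert_index[OF l, of "\<lambda>l. int (g l)"] sum_insert_index[OF i, of int] by (simp add: casoratian_degree_def)
  finally have "deg_le (smult ((- 1) ^ (l + i)) (det (mat_delete ?B l i))) (casoratian_degree g m - int (g l) + int i)"
    by (rule deg_le_smult)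
  moreover have "adj_mat ?B $$ (i, l) = smult ((- 1) ^ (l + i)) (det (mat_delete ?B l i))"
    using i l by (simp add: adj_mat_def cofactor_def dims minus_one_power_iff)
  ultimately show ?thesis by simp
qed

text \<open>Summation by parts: summing the cofactors over all windows produces an \<open>i\<close>-th difference of
  the cofactor that belongs to the column of \<open>i\<close>-th differences. The difference lowers the degree
  by \<open>i\<close>, which compensates for the degrees that this cofactor gains by missing that column.\<close>

lemma multiplier_eq:
  assumes l: "l < m"
  shows "multiplier R m l = (\<Sum>i<m. ndiff 1 i (shift 1 (adj_mat (difference_mat R m) $$ (i, l))))"
proof (rule real_poly_eqI)
  fix x :: real
  let ?a = "\<lambda>i. adj_mat (difference_mat R m) $$ (i, l)"
  have "window_inverse R m $$ (r, l) = (\<Sum>i<m. (- 1) ^ r * of_nat (i choose r) * ?a i)" if "r < m" for r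
    unfolding window_inverse_def using that l adj_difference_mat(1)
    by (subst index_mult_mat_sum[of _ m]) (auto simp: pascal_def)
  then have "poly (multiplier R m l) x =
      (\<Sum>r<m. \<Sum>i<m. (- 1) ^ r * of_nat (i choose r) * poly (?a i) (x + 1 + real r))"
    by (simp add: multiplier_def poly_sum of_nat_poly algebra_simps)
  also have "\<dots> = (\<Sum>i<m. \<Sum>r<m. (- 1) ^ r * of_nat (i choose r) * poly (?a i) (x + 1 + real r))"
    by (rule sum.swap)
  also have "\<dots> = (\<Sum>i<m. \<Sum>r\<le>i. (- 1) ^ r * of_nat (i choose r) * poly (?a i) (x + 1 + real r))"
    by (intro sum.cong refl sum.mono_neutral_right) auto
  also have "\<dots> = poly (\<Sum>i<m. ndiff 1 i (shift 1 (?a i))) x"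
    by (simp add: poly_sum poly_ndiff algebra_simps)
  finally show "poly (multiplier R m l) x = poly (\<Sum>i<m. ndiff 1 i (shift 1 (?a i))) x" .
qed

lemma multiplier_degree:
  assumes deg: "\<And>l. l < m \<Longrightarrow> deg_le (R l) (int (g l))" and l: "l < m"
  shows "deg_le (multiplier R m l) (casoratian_degree g m - int (g l))"
  unfolding multiplier_eq[OF l]
proof (rule deg_le_sum)
  fix i assume "i \<in> {..<m}"
  then have "deg_le (adj_mat (difference_mat R m) $$ (i, l)) (casoratian_degree g m - int (g l) + int i)"
    using adj_difference_mat_degree[OF deg _ l] by auto
  from deg_le_ndiff[OF deg_le_shift[OF this], of 1 i 1]
  show "deg_le (ndiff 1 i (shift 1 (adj_mat (difference_mat R m) $$ (i, l)))) (casoratian_degree g m - int (g l))"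
    by simp
qed

section \<open>Charlier polynomials and their moments\<close>

definition charlier_poly :: "real \<Rightarrow> nat \<Rightarrow> real poly" where
  "charlier_poly a n = (\<Sum>j\<le>n. smult ((- a) ^ (n - j) / (fact (n - j) * fact j)) (falling j))"

lemma poly_charlier_poly_sum: "poly (charlier_poly a n) x = (\<Sum>j\<le>n. (x gchoose j) * ((- a) ^ (n - j) / fact (n - j)))"
  by (simp add: charlier_poly_def poly_sum poly_falling_gbinomial field_simps)

lemma poly_charlier_poly: "poly (charlier_poly a n) x = charlier a n x"
proof -
  have "1 / fact n * ((- a) ^ (n - j) * real (n choose j) * (x gchoose j) * fact j) =
      (x gchoose j) * ((- a) ^ (n - j) / fact (n - j))" if "j \<le> n" for j
    using that by (simp add: binomial_fact field_simps)
  then show ?thesis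
    unfolding poly_charlier_poly_sum charlier_def sum_distrib_left atMost_atLeast0[symmetric] by simp
qed

lemma charlier_poly_generating_function:
  "Abs_fps (\<lambda>n. poly (charlier_poly a n) x) = fps_binomial x * fps_exp (- a)"
  by (rule fps_ext) (simp add: poly_charlier_poly_sum fps_mult_nth atMost_atLeast0)

text \<open>Multiplying the generating function by the inverse exponential leaves the binomial series.\<close>

lemma gbinomial_eq_charlier_poly_sum:
  "x gchoose n = (\<Sum>t\<le>n. b ^ t / fact t * poly (charlier_poly b (n - t)) x)"
proof -
  have "fps_exp b * Abs_fps (\<lambda>n. poly (charlier_poly b n) x) = (fps_exp b * fps_exp (- b)) * fps_binomial x"
    unfolding charlier_poly_generating_function by (simp only: ac_simps)
  also have "fps_exp b * fps_exp (- b) = 1"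
    by (simp flip: fps_exp_add_mult)
  finally have "fps_nth (fps_exp b * Abs_fps (\<lambda>n. poly (charlier_poly b n) x)) n = x gchoose n"
    by simp
  then show ?thesis by (simp add: fps_mult_nth atMost_atLeast0)
qed

lemma degree_charlier_poly [simp]: "degree (charlier_poly a n) = n" and lead_coeff_charlier_poly: "coeff (charlier_poly a n) n = 1 / fact n"
proof -
  have "coeff (charlier_poly a n) n = (\<Sum>j\<in>{n}. (- a) ^ (n - j) / (fact (n - j) * fact j) * coeff (falling j) n)"
    unfolding charlier_poly_def coeff_sum coeff_smult
    by (intro sum.mono_neutral_right) (auto intro!: coeff_eq_0)
  then show lead: "coeff (charlier_poly a n) n = 1 / fact n" by simp
  have "degree (charlier_poly a n) \<le> n"
    unfolding charlier_poly_def by (intro degree_sum_le) (auto intro: order_trans[OF degree_smult_le])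
  moreover have "n \<le> degree (charlier_poly a n)"
    by (rule le_degree) (simp add: lead)
  ultimately show "degree (charlier_poly a n) = n" by simp
qed

lemma charlier_poly_nonzero [simp]: "charlier_poly a n \<noteq> 0"
  using lead_coeff_charlier_poly[of a n] by auto

lemma charlier_poly_0 [simp]: "charlier_poly a 0 = 1"
  by (simp add: charlier_poly_def)

lemma shift_1_charlier_poly: "shift 1 (charlier_poly a (Suc n)) = charlier_poly a (Suc n) + charlier_poly a n"
proof (rule real_poly_eqI)
  fix x :: real
  have "fps_binomial (x + 1) * fps_exp (- a) = (1 + fps_X) * (fps_binomial x * fps_exp (- a))"
    by (simp add: fps_binomial_add_mult fps_binomial_1 mult_ac)
  then have "Abs_fps (\<lambda>n. poly (charlier_poly a n) (x + 1)) = (1 + fps_X) * Abs_fps (\<lambda>n. poly (charlier_poly a n) x)"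
    by (simp only: charlier_poly_generating_function)
  then have "fps_nth (Abs_fps (\<lambda>n. poly (charlier_poly a n) (x + 1))) (Suc n) = 
      fps_nth ((1 + fps_X) * Abs_fps (\<lambda>n. poly (charlier_poly a n) x)) (Suc n)" by simp
  then show "poly (shift 1 (charlier_poly a (Suc n))) x = poly (charlier_poly a (Suc n) + charlier_poly a n) x"
    by (simp add: distrib_right)
qed

text \<open>The derivative of the generating function in its formal variable, read coefficientwise.\<close>

lemma charlier_poly_ladder:
  "x * poly (charlier_poly a n) (x - 1) = real (Suc n) * poly (charlier_poly a (Suc n)) x + a * poly (charlier_poly a n) x"
proof -
  let ?d = "\<lambda>j. (- a) ^ (Suc n - j) / fact (Suc n - j) :: real"
  have absorb: "x * ((x - 1) gchoose j) = real (Suc j) * (x gchoose Suc j)" for j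
    using gbinomial_absorption'[of "Suc j" x] by simp
  have "x * poly (charlier_poly a n) (x - 1) = (\<Sum>j\<le>n. real (Suc j) * (x gchoose Suc j) * ?d (Suc j))"
    unfolding poly_charlier_poly_sum sum_distrib_left
    by (simp only: mult.assoc[symmetric] absorb diff_Suc_Suc)
  also have "\<dots> = (\<Sum>j\<le>Suc n. real j * (x gchoose j) * ?d j)"
    by (subst sum.atMost_Suc_shift) simp
  also have "\<dots> = (\<Sum>j\<le>Suc n. real (Suc n) * ((x gchoose j) * ?d j) - real (Suc n - j) * ((x gchoose j) * ?d j))"
  proof (intro sum.cong refl)
    fix j assume "j \<in> {..Suc n}"
    then have j: "real j = real (Suc n) - real (Suc n - j)" by (simp add: of_nat_diff)
    show "real j * (x gchoose j) * ?d j = real (Suc n) * ((x gchoose j) * ?d j) - real (Suc n - j) * ((x gchoose j) * ?d j)"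
      by (subst j) (simp only: left_diff_distrib mult.assoc)
  qed
  also have "\<dots> = real (Suc n) * poly (charlier_poly a (Suc n)) x - (\<Sum>j\<le>Suc n. real (Suc n - j) * ((x gchoose j) * ?d j))"
    by (simp only: sum_subtractf poly_charlier_poly_sum sum_distrib_left)
  also have "(\<Sum>j\<le>Suc n. real (Suc n - j) * ((x gchoose j) * ?d j)) = - a * poly (charlier_poly a n) x"
  proof -
    have "real (Suc n - j) * ((x gchoose j) * ?d j) = - a * ((x gchoose j) * ((- a) ^ (n - j) / fact (n - j)))"
      if "j \<le> n" for j
    proof -
      have "Suc n - j = Suc (n - j)" using that by simp
      then show ?thesis by (simp add: field_simps del: of_nat_Suc)
    qed
    then show ?thesis by (simp add: poly_charlier_poly_sum sum_distrib_left)
  qed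
  finally show ?thesis by simp
qed

lemma charlier_measure_alt: "charlier_measure a p = (\<Sum>x. a ^ x / fact x * poly p (real x))"
  by (simp add: charlier_measure_def dirac_def)

lemma summable_charlier: "summable (\<lambda>x. a ^ x / fact x * poly p (real x))"
  using summable_charlier_measure[of a p] by (simp add: dirac_def)

lemma charlier_measure_add: "charlier_measure a (p + q) = charlier_measure a p + charlier_measure a q"
  using suminf_add[OF summable_charlier[of a p] summable_charlier[of a q]]
  by (simp add: charlier_measure_alt algebra_simps)

lemma charlier_measure_smult: "charlier_measure a (smult c p) = c * charlier_measure a p"
  using suminf_mult[OF summable_charlier[of a p], of c]
  by (simp add: charlier_measure_alt algebra_simps)

lemma charlier_measure_0: "charlier_measure a 0 = 0"
  by (simp add: charlier_measure_alt)

lemma charlier_measure_sum: "charlier_measure a (\<Sum>i\<in>I. f i) = (\<Sum>i\<in>I. charlier_measure a (f i))"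
  by (induction I rule: infinite_finite_induct) (auto simp: charlier_measure_add charlier_measure_0)

lemma charlier_measure_1: "charlier_measure a 1 = exp a"
  by (simp add: charlier_measure_alt exp_def divide_inverse mult.commute)

text \<open>The weight satisfies \<open>x a\<^sup>x / x! = a a\<^bsup>x-1\<^esup> / (x-1)!\<close>.\<close>

lemma charlier_measure_X: "charlier_measure a ([:0, 1:] * p) = a * charlier_measure a (shift 1 p)"
proof -
  have "charlier_measure a ([:0, 1:] * p) = (\<Sum>x. a ^ Suc x / fact (Suc x) * poly ([:0, 1:] * p) (real (Suc x)))"
    unfolding charlier_measure_alt by (subst suminf_split_head[OF summable_charlier]) simp
  also have "\<dots> = (\<Sum>x. a * (a ^ x / fact x * poly (shift 1 p) (real x)))"
  proof (rule arg_cong[of _ _ suminf], rule ext)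
    fix x
    have "real (Suc x) = real x + 1" by simp
    then have "poly p (real (Suc x)) = poly p (real x + 1)" by (rule arg_cong)
    then show "a ^ Suc x / fact (Suc x) * poly ([:0, 1:] * p) (real (Suc x)) = a * (a ^ x / fact x * poly (shift 1 p) (real x))"
      by (simp add: field_simps del: of_nat_Suc)
  qed
  also have "\<dots> = a * charlier_measure a (shift 1 p)"
    unfolding charlier_measure_alt by (rule suminf_mult[OF summable_charlier])
  finally show ?thesis .
qed

lemma falling_Suc_shift: "falling (Suc i) = [:0, 1:] * shift (- 1) (falling i)"
  by (rule real_poly_eqI) (simp add: poly_falling prod.lessThan_Suc_shift algebra_simps del: prod.lessThan_Suc)

lemma charlier_measure_falling: "charlier_measure a (falling i * p) = a ^ i * charlier_measure a (shift (int i) p)"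
proof (induction i arbitrary: p)
  case (Suc i)
  have "charlier_measure a (falling (Suc i) * p) = a * charlier_measure a (falling i * shift 1 p)"
    unfolding falling_Suc_shift mult.assoc charlier_measure_X by (simp add: shift_mult shift_shift)
  also have "\<dots> = a ^ Suc i * charlier_measure a (shift (int (Suc i)) p)"
    by (simp add: Suc.IH shift_shift add.commute)
  finally show ?case .
qed simp

lemma charlier_measure_charlier_poly: "charlier_measure a (charlier_poly a n) = (if n = 0 then exp a else 0)"
proof (cases "n = 0")
  case False
  have "charlier_measure a (falling j) = a ^ j * exp a" for j
    using charlier_measure_falling[of a j 1] charlier_measure_1[of a]
    by simp
  then have "charlier_measure a (charlier_poly a n) = (\<Sum>j\<le>n. (- a) ^ (n - j) / (fact (n - j) * fact j) * (a ^ j * exp a))"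
    by (simp add: charlier_poly_def charlier_measure_sum charlier_measure_smult)
  also have "\<dots> = exp a / fact n * (\<Sum>j\<le>n. of_nat (n choose j) * a ^ j * (- a) ^ (n - j))"
    unfolding sum_distrib_left by (intro sum.cong) (auto simp: binomial_fact field_simps)
  also have "\<dots> = exp a / fact n * (a + - a) ^ n"
    by (simp only: binomial_ring)
  finally show ?thesis using False by simp
qed (simp add: charlier_measure_1)

text \<open>For \<open>u = 0\<close> this is orthogonality to constants. Both sides obey the Pascal recurrence in
  \<open>u\<close>, which reaches all integers in both directions.\<close>

lemma charlier_measure_shift_charlier_poly:
  "charlier_measure a (shift u (charlier_poly a n)) = exp a * (of_int u gchoose n)"
proof (induction n arbitrary: u)
  case 0
  then show ?case by (simp add: charlier_measure_1)
next
  case (Suc n)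
  define f where "f u = charlier_measure a (shift u (charlier_poly a (Suc n)))" for u
  have step: "f (u + 1) = f u + exp a * (of_int u gchoose n)" for u
  proof -
    have "shift (u + 1) (charlier_poly a (Suc n)) = shift u (charlier_poly a (Suc n)) + shift u (charlier_poly a n)"
      using shift_1_charlier_poly[of a n] by (metis shift_add shift_shift)
    then show ?thesis by (simp add: f_def charlier_measure_add Suc.IH)
  qed
  have pascal: "(of_int (u + 1) gchoose Suc n) = (of_int u gchoose n) + (of_int u gchoose Suc n :: real)" for u
    using gbinomial_Suc_Suc[of "of_int u :: real" n] by simp
  have "f u = exp a * (of_int u gchoose Suc n)"
  proof (induction u rule: int_induct[of _ 0])
    case base
    then show ?case by (simp add: f_def charlier_measure_charlier_poly)
  next
    case (step1 u)
    then show ?case using step[of u] pascal[of u] by (simp add: algebra_simps)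
  next
    case (step2 u)
    then show ?case using step[of "u - 1"] pascal[of "u - 1"] by (simp add: algebra_simps)
  qed
  then show ?case by (simp add: f_def)
qed

text \<open>The sign makes the backward shift act by summation without signs.\<close>

definition signed_charlier :: "real \<Rightarrow> int \<Rightarrow> nat \<Rightarrow> real poly" where
  "signed_charlier a c n = smult ((- 1) ^ n) (shift (- c) (charlier_poly a n))"

lemma degree_signed_charlier [simp]: "degree (signed_charlier a c n) = n"
  by (simp add: signed_charlier_def)

lemma charlier_measure_falling_signed_charlier:
  "charlier_measure a (falling i * signed_charlier a c n) =
     (- 1) ^ n * a ^ i * exp a * (of_int (int i - c) gchoose n)"
  by (simp add: signed_charlier_def charlier_measure_smult charlier_measure_falling shift_shift charlier_measure_shift_charlier_poly)

lemma signed_charlier_0: "signed_charlier a c 0 = 1"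
  by (simp add: signed_charlier_def)

lemma shift_down_signed_charlier: "shift (- 1) (signed_charlier a c n) = (\<Sum>i\<le>n. signed_charlier a c i)"
proof (induction n)
  case 0
  then show ?case by (simp add: signed_charlier_0)
next
  case (Suc n)
  have "charlier_poly a (Suc n) = shift (- 1) (charlier_poly a (Suc n)) + shift (- 1) (charlier_poly a n)"
    using arg_cong[OF shift_1_charlier_poly[of a n], of "shift (- 1)"] by (simp add: shift_add shift_shift)
  then have "shift (- c) (charlier_poly a (Suc n)) = shift (- 1) (shift (- c) (charlier_poly a (Suc n))) + shift (- 1) (shift (- c) (charlier_poly a n))"
    by (metis shift_add shift_shift add.commute)
  then have "smult ((- 1) ^ Suc n) (shift (- c) (charlier_poly a (Suc n))) = smult ((- 1) ^ Suc n)
      (shift (- 1) (shift (- c) (charlier_poly a (Suc n))) + shift (- 1) (shift (- c) (charlier_poly a n)))"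
    by (rule arg_cong)
  then have "signed_charlier a c (Suc n) = shift (- 1) (signed_charlier a c (Suc n)) - shift (- 1) (signed_charlier a c n)"
    unfolding signed_charlier_def shift_smult by (simp add: smult_add_right)
  then show ?case using Suc by (simp add: algebra_simps)
qed

text \<open>The second order difference operator of the Charlier polynomials, translated by \<open>c\<close> and
  normalized to have the eigenvalues \<open>n\<close>.\<close>

definition charlier_op :: "real \<Rightarrow> int \<Rightarrow> real poly \<Rightarrow> real poly" where
  "charlier_op a c p =
     [:- of_int c, 1:] * (p - shift (- 1) p) + smult a (p - shift 1 p)"

lemma charlier_op_signed_charlier: "charlier_op a c (signed_charlier a c n) = smult (real n) (signed_charlier a c n)"
proof (rule real_poly_eqI)
  fix x :: real
  define y where "y = x - of_int c"
  let ?C = "\<lambda>n. poly (charlier_poly a n)"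
  have up: "?C (Suc n) (z + 1) = ?C (Suc n) z + ?C n z" for n z
    using arg_cong[OF shift_1_charlier_poly[of a n], of "\<lambda>p. poly p z"] by simp
  have "y * (?C n y - ?C n (y - 1)) + a * (?C n y - ?C n (y + 1)) = real n * ?C n y"
  proof (cases n)
    case (Suc k)
    have 1: "?C (Suc n) y = ?C (Suc n) (y - 1) + ?C n (y - 1)" "?C n y = ?C n (y - 1) + ?C k (y - 1)"
      using up[of n "y - 1"] up[of k "y - 1"] Suc by simp_all
    have "y * (?C n y - ?C n (y - 1)) = y * ?C k (y - 1)"
      using 1 by simp
    also have "\<dots> = real n * ?C n y + a * ?C k y"
      using charlier_poly_ladder[of y a k] Suc by simp
    finally show ?thesis using up[of k y] Suc by (simp add: algebra_simps)
  qed simp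
  then have "(- 1) ^ n * (y * (?C n y - ?C n (y - 1)) + a * (?C n y - ?C n (y + 1))) = (- 1) ^ n * (real n * ?C n y)"
    by (rule arg_cong)
  then show "poly (charlier_op a c (signed_charlier a c n)) x = poly (smult (real n) (signed_charlier a c n)) x"
    by (simp add: charlier_op_def signed_charlier_def y_def algebra_simps)
qed

text \<open>For \<open>y = - n - 1\<close> the right-hand side is, up to the factor \<open>exp a\<close>, the polynomial in \<open>n\<close> that
  gives the \<open>n\<close>-th moment of a polynomial of degree at most \<open>M\<close> with Newton coefficients \<open>v\<close>; the left-hand side writes it in Charlier
  polynomials with the values at \<open>0, \<dots>, M\<close> as coefficients. Roots of \<open>S\<close> therefore remove
  the corresponding Charlier polynomials. Both sides are linear in \<open>S\<close>, so a falling
  factorial suffices, where the identity inverts the definition of the Charlier polynomials.\<close>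

lemma casorati_span:
  assumes S: "\<And>s. s \<le> M \<Longrightarrow> poly S (real s) = (\<Sum>i\<le>M. v i * poly (falling i) (real s))"
  shows "(\<Sum>s\<le>M. poly S (real s) * a ^ s / fact s * (- 1) ^ (M - s) * poly (charlier_poly (- a) (M - s)) y) =
         (\<Sum>i\<le>M. v i * a ^ i * (- 1) ^ (M - i) * (y gchoose (M - i)))"
proof -
  define w where "w s = a ^ s / fact s * (- 1) ^ (M - s) * poly (charlier_poly (- a) (M - s)) y" for s
  have "(\<Sum>s\<le>M. poly (falling i) (real s) * w s) = a ^ i * (- 1) ^ (M - i) * (y gchoose (M - i))"
    if i: "i \<le> M" for i
  proof -
    have "(\<Sum>s\<le>M. poly (falling i) (real s) * w s) = (\<Sum>s\<in>{i..M}. poly (falling i) (real s) * w s)"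
      by (intro sum.mono_neutral_right) (auto simp: poly_falling_small not_le)
    also have "\<dots> = (\<Sum>t\<le>M - i. poly (falling i) (real (i + t)) * w (i + t))"
      using i by (intro sum.reindex_bij_witness[of _ "\<lambda>t. i + t" "\<lambda>s. s - i"]) auto
    also have "\<dots> = (\<Sum>t\<le>M - i. a ^ i * (- 1) ^ (M - i) * ((- a) ^ t / fact t * poly (charlier_poly (- a) (M - i - t)) y))"
    proof (intro sum.cong refl)
      fix t assume t: "t \<in> {..M - i}"
      have "poly (falling i) (real (i + t)) = fact (i + t) / fact t"
        using binomial_fact[of i "i + t", where ?'a = real]
        by (simp add: poly_falling_gbinomial binomial_gbinomial field_simps)
      moreover have "(- 1) ^ (M - i) * (- 1) ^ t = ((- 1) ^ (M - (i + t)) :: real)"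
        using t i by (auto simp: minus_one_power_iff)
      moreover have "(- a) ^ t = (- 1) ^ t * a ^ t" by (rule power_minus)
      ultimately show "poly (falling i) (real (i + t)) * w (i + t) =
          a ^ i * (- 1) ^ (M - i) * ((- a) ^ t / fact t * poly (charlier_poly (- a) (M - i - t)) y)"
        by (simp add: w_def power_add)
    qed
    also have "\<dots> = a ^ i * (- 1) ^ (M - i) * (y gchoose (M - i))"
      by (simp only: gbinomial_eq_charlier_poly_sum[of y "M - i" "- a"] sum_distrib_left)
    finally show ?thesis .
  qed
  then have "(\<Sum>i\<le>M. v i * (\<Sum>s\<le>M. poly (falling i) (real s) * w s)) =
      (\<Sum>i\<le>M. v i * a ^ i * (- 1) ^ (M - i) * (y gchoose (M - i)))"
    by (intro sum.cong) (auto simp: mult_ac)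
  moreover have "(\<Sum>i\<le>M. v i * (\<Sum>s\<le>M. poly (falling i) (real s) * w s)) = (\<Sum>s\<le>M. poly S (real s) * w s)"
    by (simp add: S sum_distrib_left sum_distrib_right mult_ac) (rule sum.swap)
  ultimately show ?thesis by (simp add: w_def mult_ac)
qed

section \<open>Eigenfunctions from Casorati determinants\<close>

lemma smult_sum_right: "smult c (\<Sum>i\<in>I. f i) = (\<Sum>i\<in>I. smult c (f i))"
  by (induction I rule: infinite_finite_induct) (auto simp: smult_add_right)

definition linear_op :: "(real poly \<Rightarrow> real poly) \<Rightarrow> bool" where
  "linear_op T \<longleftrightarrow> (\<forall>p q. T (p + q) = T p + T q) \<and> (\<forall>c p. T (smult c p) = smult c (T p))"

lemma linear_opD:
  assumes "linear_op T"
  shows "T (p + q) = T p + T q" and "T (smult c p) = smult c (T p)"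
  using assms by (auto simp: linear_op_def)

lemma linear_op_sum:
  assumes T: "linear_op T"
  shows "T (\<Sum>i\<in>I. smult (c i) (f i)) = (\<Sum>i\<in>I. smult (c i) (T (f i)))"
proof -
  have "T 0 = 0" using linear_opD(2)[OF T, of 0 0] by simp
  then show ?thesis
    by (induction I rule: infinite_finite_induct) (auto simp: linear_opD[OF T])
qed

lemma linear_op_shift: "linear_op (shift l)"
  by (simp add: linear_op_def shift_add shift_smult)

lemma linear_op_charlier_op: "linear_op (charlier_op a c)"
  unfolding linear_op_def
  by (intro conjI allI; rule real_poly_eqI) (simp_all add: charlier_op_def algebra_simps)

lemma linear_op_funpow: "linear_op T \<Longrightarrow> linear_op (T ^^ i)"
  by (induction i) (auto simp: linear_op_def)

definition op_poly :: "real poly \<Rightarrow> (real poly \<Rightarrow> real poly) \<Rightarrow> real poly \<Rightarrow> real poly" where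
  "op_poly P T p = (\<Sum>i\<le>degree P. smult (coeff P i) ((T ^^ i) p))"

lemma linear_op_op_poly:
  assumes "linear_op T"
  shows "linear_op (op_poly P T)"
  using linear_opD[OF linear_op_funpow[OF assms]]
  by (simp add: linear_op_def op_poly_def smult_add_right sum.distrib smult_sum_right mult.commute)

lemma op_poly_eigenvector:
  assumes "linear_op T" and "T v = smult x v"
  shows "op_poly P T v = smult (poly P x) v"
proof -
  have "(T ^^ i) v = smult (x ^ i) v" for i
    by (induction i) (simp_all add: assms linear_opD mult.commute)
  then show ?thesis
    by (simp add: op_poly_def poly_altdef smult_sum)
qed

text \<open>Here \<open>T\<close> is an operator that acts on a basis \<open>e\<close> by \<open>e n \<mapsto> n e n\<close>, so \<open>op_poly P T\<close> multiplies
  \<open>e n\<close> by \<open>P(n)\<close>.\<close>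

definition cas_operator ::
    "(nat \<Rightarrow> real poly) \<Rightarrow> nat \<Rightarrow> real poly \<Rightarrow> (real poly \<Rightarrow> real poly) \<Rightarrow> real poly \<Rightarrow> real poly" where
  "cas_operator R m \<Lambda> T p = op_poly (shift (int m) \<Lambda>) T p -
     (\<Sum>l<m. op_poly (multiplier R m l) T (shift (- 1) (op_poly (R l) T p)))"

text \<open>The sum may run up to \<open>n\<close> because \<open>cas_coeff\<close> vanishes beyond \<open>m\<close>; indices with \<open>n < j\<close> would
  refer to basis elements of negative degree, which count as zero.\<close>

definition cas_poly :: "(nat \<Rightarrow> real poly) \<Rightarrow> nat \<Rightarrow> (nat \<Rightarrow> real poly) \<Rightarrow> nat \<Rightarrow> real poly" where
  "cas_poly R m e n = (\<Sum>j\<le>n. smult (cas_coeff R m (real n) j) (e (n - j)))"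

lemma cas_coeff_relation':
  assumes "l < m" and "m \<le> h"
  shows "(\<Sum>j\<le>h. cas_coeff R m x j * poly (R l) (x - real j)) = 0"
proof -
  have "(\<Sum>j\<le>h. cas_coeff R m x j * poly (R l) (x - real j)) = (\<Sum>j\<le>m. cas_coeff R m x j * poly (R l) (x - real j))"
    using assms(2) by (intro sum.mono_neutral_right) (auto simp: cas_coeff_def)
  then show ?thesis using cas_coeff_relation[OF assms(1)] by simp
qed

lemma multiplier_partial_sum_telescoped:
  assumes \<Lambda>: "\<Lambda> - shift (- 1) \<Lambda> = casoratian R m"
  shows "(\<Sum>l<m. poly (multiplier R m l) (x - real h) * (\<Sum>j\<le>h. cas_coeff R m x j * poly (R l) (x - real j))) =
         cas_coeff R m x h * (poly \<Lambda> (x - real h + real m) - poly \<Lambda> x)"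
proof (cases "h \<le> m")
  case True
  have "poly (casoratian R m) (x - real h + 1 + real r) = poly \<Lambda> (x - real h + real (Suc r)) - poly \<Lambda> (x - real h + real r)" for r
    unfolding \<Lambda>[symmetric] by (simp add: algebra_simps)
  then have "(\<Sum>r\<in>{h..<m}. poly (casoratian R m) (x - real h + 1 + real r)) = poly \<Lambda> (x - real h + real m) - poly \<Lambda> (x - real h + real h)"
    by (simp only: sum_Suc_diff'[OF True, of "\<lambda>r. poly \<Lambda> (x - real h + real r)"])
  then show ?thesis by (simp add: multiplier_partial_sum[OF True])
next
  case False
  then have "cas_coeff R m x h = 0" by (simp add: cas_coeff_def)
  then show ?thesis using False by (simp add: cas_coeff_relation')
qed

text \<open>Since the backward shift sums over the basis, the coefficients after applying \<open>R l\<close> and the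
  shift are partial sums of the kernel relation, to which \<open>multiplier_partial_sum_telescoped\<close>
  applies. The resulting factor differs from \<open>\<Lambda>(n - h + m)\<close> by \<open>\<Lambda>(n)\<close>, independently of \<open>h\<close>.\<close>

lemma cas_operator_eigen:
  assumes T: "linear_op T" and eig: "\<And>n. T (e n) = smult (real n) (e n)"
    and down: "\<And>n. shift (- 1) (e n) = (\<Sum>i\<le>n. e i)"
    and \<Lambda>: "\<Lambda> - shift (- 1) \<Lambda> = casoratian R m"
  shows "cas_operator R m \<Lambda> T (cas_poly R m e n) = smult (poly \<Lambda> (real n)) (cas_poly R m e n)"
proof -
  define b where "b = cas_coeff R m (real n)"
  define U where "U l h = (\<Sum>j\<le>h. b j * poly (R l) (real n - real j))" for l h
  have P: "op_poly P T (\<Sum>j\<le>n. smult (v j) (e (n - j))) = (\<Sum>j\<le>n. smult (v j * poly P (real n - real j)) (e (n - j)))"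
    for P v
    unfolding linear_op_sum[OF linear_op_op_poly[OF T]] op_poly_eigenvector[OF T eig]
    by (intro sum.cong) (auto simp: of_nat_diff)
  have inner: "shift (- 1) (op_poly (R l) T (cas_poly R m e n)) = (\<Sum>h\<le>n. smult (U l h) (e (n - h)))" for l
  proof -
    let ?w = "\<lambda>j. b j * poly (R l) (real n - real j)"
    have "(\<Sum>i\<le>n - j. e i) = (\<Sum>h\<le>n. if j \<le> h then e (n - h) else 0)" if "j \<le> n" for j
    proof -
      have "(\<Sum>i\<le>n - j. e i) = (\<Sum>h\<in>{j..n}. e (n - h))"
        using that by (intro sum.reindex_bij_witness[of _ "\<lambda>h. n - h" "\<lambda>i. n - i"]) auto
      also have "\<dots> = (\<Sum>h\<le>n. if j \<le> h then e (n - h) else 0)"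
        by (intro sum.mono_neutral_cong_left) auto
      finally show ?thesis .
    qed
    then have "shift (- 1) (op_poly (R l) T (cas_poly R m e n)) =
        (\<Sum>j\<le>n. smult (?w j) (\<Sum>h\<le>n. if j \<le> h then e (n - h) else 0))"
      unfolding cas_poly_def P linear_op_sum[OF linear_op_shift] down b_def by (intro sum.cong) auto
    also have "\<dots> = (\<Sum>j\<le>n. \<Sum>h\<le>n. smult (if j \<le> h then ?w j else 0) (e (n - h)))"
      by (simp add: smult_sum_right if_distrib[of "smult _"] cong: if_cong) (intro sum.cong; simp)
    also have "\<dots> = (\<Sum>h\<le>n. smult (\<Sum>j\<le>n. if j \<le> h then ?w j else 0) (e (n - h)))"
      by (subst sum.swap) (simp add: smult_sum)
    also have "\<dots> = (\<Sum>h\<le>n. smult (U l h) (e (n - h)))"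
      unfolding U_def
      by (intro sum.cong refl arg_cong2[of _ _ _ _ smult] sum.mono_neutral_cong_right) auto
    finally show ?thesis .
  qed
  have "(\<Sum>l<m. op_poly (multiplier R m l) T (shift (- 1) (op_poly (R l) T (cas_poly R m e n)))) =
      (\<Sum>h\<le>n. smult (\<Sum>l<m. poly (multiplier R m l) (real n - real h) * U l h) (e (n - h)))"
    unfolding inner P by (subst sum.swap) (simp add: smult_sum mult.commute)
  also have "\<dots> = (\<Sum>h\<le>n. smult (b h * (poly \<Lambda> (real n - real h + real m) - poly \<Lambda> (real n))) (e (n - h)))"
    unfolding U_def b_def multiplier_partial_sum_telescoped[OF \<Lambda>] ..
  finally have second: "(\<Sum>l<m. op_poly (multiplier R m l) T (shift (- 1) (op_poly (R l) T (cas_poly R m e n)))) =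
      (\<Sum>h\<le>n. smult (b h * (poly \<Lambda> (real n - real h + real m) - poly \<Lambda> (real n))) (e (n - h)))" .
  have first: "op_poly (shift (int m) \<Lambda>) T (cas_poly R m e n) =
      (\<Sum>h\<le>n. smult (b h * poly \<Lambda> (real n - real h + real m)) (e (n - h)))"
    unfolding cas_poly_def P b_def by simp
  have "cas_operator R m \<Lambda> T (cas_poly R m e n) = (\<Sum>h\<le>n. smult (b h * poly \<Lambda> (real n)) (e (n - h)))"
    unfolding cas_operator_def first second sum_subtractf[symmetric] smult_diff_left[symmetric]
    by (simp add: algebra_simps)
  then show ?thesis
    by (simp add: cas_poly_def b_def smult_sum_right mult.commute)
qed

section \<open>Extreme coefficients of difference operators\<close>

definition shift_expansion :: "(real poly \<Rightarrow> real poly) \<Rightarrow> int \<Rightarrow> int \<Rightarrow> (int \<Rightarrow> real poly) \<Rightarrow> bool" where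
  "shift_expansion T u v h \<longleftrightarrow>
     (\<forall>l. h l \<noteq> 0 \<longrightarrow> - u \<le> l \<and> l \<le> v) \<and> (\<forall>p. T p = (\<Sum>l=-u..v. h l * shift l p))"

lemma shift_expansion_zero: "shift_expansion T u v h \<Longrightarrow> l < - u \<or> v < l \<Longrightarrow> h l = 0"
  unfolding shift_expansion_def by force

lemma shift_expansion_range:
  assumes "shift_expansion T u v h" and "A \<le> - u" and "v \<le> B"
  shows "T p = (\<Sum>l=A..B. h l * shift l p)"
proof -
  have "(\<Sum>l=-u..v. h l * shift l p) = (\<Sum>l=A..B. h l * shift l p)"
    using assms by (intro sum.mono_neutral_left) (auto simp: shift_expansion_zero[OF assms(1)])
  then show ?thesis using assms(1) by (simp add: shift_expansion_def)
qed

lemma shift_expansion_shift: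
  assumes T: "shift_expansion T u v h" and "A \<le> k - u" and "v + k \<le> B"
  shows "shift k (T p) = (\<Sum>l=A..B. shift k (h (l - k)) * shift l p)"
proof -
  have "shift k (T p) = (\<Sum>l=A-k..B-k. shift k (h l) * shift (k + l) p)"
  proof -
    have "A - k \<le> - u" "v \<le> B - k" using assms(2,3) by auto
    then have "T p = (\<Sum>l=A-k..B-k. h l * shift l p)" by (rule shift_expansion_range[OF T])
    then show ?thesis by (simp only: shift_sum shift_mult shift_shift)
  qed
  also have "\<dots> = (\<Sum>l=A..B. shift k (h (l - k)) * shift l p)"
    by (rule sum.reindex_bij_witness[of _ "\<lambda>l. l - k" "\<lambda>l. l + k"]) (auto simp: add.commute)
  finally show ?thesis .
qed

text \<open>The two ends of an operator are followed through compositions: the coefficient of the lowest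
  shift by a degree bound \<open>d\<close> and its coefficient \<open>e\<close> there, the coefficient of the highest
  shift by its constant value \<open>f\<close>. Ends \<open>e = f = 0\<close> mean that the operator is negligible at
  both places.\<close>

definition has_ends :: "(real poly \<Rightarrow> real poly) \<Rightarrow> int \<Rightarrow> int \<Rightarrow> int \<Rightarrow> real \<Rightarrow> real \<Rightarrow> bool" where
  "has_ends T u v d e f \<longleftrightarrow>
     (\<exists>h. shift_expansion T u v h \<and> deg_le (h (- u)) d \<and> icoeff (h (- u)) d = e \<and> h v = [:f:])"

lemma has_ends_id: "has_ends (\<lambda>p. p) 0 0 0 1 1"
  unfolding has_ends_def
  by (rule exI[of _ "\<lambda>l. if l = 0 then 1 else 0"])
    (auto simp: shift_expansion_def deg_le_def icoeff_def coeff_eq_0 simp flip: one_pCons)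

lemma has_ends_zero: "has_ends (\<lambda>p. 0) u v d 0 0"
  unfolding has_ends_def by (rule exI[of _ "\<lambda>l. 0"]) (auto simp: shift_expansion_def)

lemma has_ends_add:
  assumes "has_ends T u v d e f" and "has_ends T' u v d e' f'"
  shows "has_ends (\<lambda>p. T p + T' p) u v d (e + e') (f + f')"
proof -
  obtain h where h: "shift_expansion T u v h" "deg_le (h (- u)) d" "icoeff (h (- u)) d = e" "h v = [:f:]"
    using assms(1) unfolding has_ends_def by blast
  obtain h' where h': "shift_expansion T' u v h'" "deg_le (h' (- u)) d" "icoeff (h' (- u)) d = e'" "h' v = [:f':]"
    using assms(2) unfolding has_ends_def by blast
  have "h l + h' l \<noteq> 0 \<Longrightarrow> - u \<le> l \<and> l \<le> v" for l
    using h(1) h'(1) unfolding shift_expansion_def by (cases "h l = 0") auto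
  then have "shift_expansion (\<lambda>p. T p + T' p) u v (\<lambda>l. h l + h' l)"
    using h(1) h'(1) unfolding shift_expansion_def by (simp add: distrib_right sum.distrib)
  then show ?thesis
    unfolding has_ends_def using h h' by (intro exI[of _ "\<lambda>l. h l + h' l"]) (auto intro: deg_le_add)
qed

lemma has_ends_smult:
  assumes "has_ends T u v d e f"
  shows "has_ends (\<lambda>p. smult c (T p)) u v d (c * e) (c * f)"
proof -
  obtain h where h: "shift_expansion T u v h" "deg_le (h (- u)) d" "icoeff (h (- u)) d = e" "h v = [:f:]"
    using assms unfolding has_ends_def by blast
  then have "shift_expansion (\<lambda>p. smult c (T p)) u v (\<lambda>l. smult c (h l))"
    unfolding shift_expansion_def by (simp add: smult_sum_right)
  then show ?thesis
    unfolding has_ends_def using h by (intro exI[of _ "\<lambda>l. smult c (h l)"]) (auto intro: deg_le_smult)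
qed

lemma has_ends_sum_zero:
  "(\<And>i. i \<in> I \<Longrightarrow> has_ends (F i) u v d 0 0) \<Longrightarrow> has_ends (\<lambda>p. \<Sum>i\<in>I. F i p) u v d 0 0"
proof (induction I rule: infinite_finite_induct)
  case (insert i I)
  then show ?case using has_ends_add[of "F i" u v d 0 0 "\<lambda>p. \<Sum>i\<in>I. F i p" 0 0] by simp
qed (simp_all add: has_ends_zero)

lemma has_ends_weaken:
  assumes "has_ends T u v d e f" and "u \<le> U" and "v < V" and "u < U \<or> d < D"
  shows "has_ends T U V D 0 0"
proof -
  obtain h where h: "shift_expansion T u v h" "deg_le (h (- u)) d"
    using assms(1) unfolding has_ends_def by blast
  have "shift_expansion T U V h"
    using h(1) assms(2,3) shift_expansion_range[OF h(1), of "- U" V] unfolding shift_expansion_def by force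
  moreover have "h V = [:0:]"
    using shift_expansion_zero[OF h(1), of V] assms(3) by simp
  moreover have "deg_le (h (- U)) D \<and> icoeff (h (- U)) D = 0"
  proof (cases "u < U")
    case True
    then show ?thesis using shift_expansion_zero[OF h(1), of "- U"] by simp
  next
    case False
    then have "u = U" "d < D" using assms by auto
    then show ?thesis using h(2) deg_le_mono[OF h(2), of D] icoeff_eq_0_above[OF h(2)] by auto
  qed
  ultimately show ?thesis unfolding has_ends_def by blast
qed

lemma shift_const [simp]: "shift l [:f:] = [:f:]"
  by (rule real_poly_eqI) simp

lemma has_ends_shift_down:
  assumes "has_ends T u v d e f"
  shows "has_ends (\<lambda>p. shift (- 1) (T p)) (u + 1) (v - 1) d e f"
proof -
  obtain h where h: "shift_expansion T u v h" "deg_le (h (- u)) d" "icoeff (h (- u)) d = e" "h v = [:f:]"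
    using assms unfolding has_ends_def by blast
  let ?H = "\<lambda>l. shift (- 1) (h (l + 1))"
  have "shift_expansion (\<lambda>p. shift (- 1) (T p)) (u + 1) (v - 1) ?H"
    using h(1) shift_expansion_shift[OF h(1), of "- (u + 1)" "- 1" "v - 1"]
    unfolding shift_expansion_def by force
  moreover have "?H (- (u + 1)) = shift (- 1) (h (- u))" by simp
  ultimately show ?thesis
    unfolding has_ends_def using h
    by (intro exI[of _ ?H]) (simp add: deg_le_shift icoeff_shift)
qed

text \<open>Only one of the three terms of the Charlier operator reaches each end: the term with the backward
  shift multiplies the lowest coefficient by minus a monic linear polynomial, the term with the
  forward shift multiplies the highest one by \<open>- a\<close>.\<close>

lemma has_ends_charlier_op:
  assumes "has_ends T u v d e f"
  shows "has_ends (\<lambda>p. charlier_op a c (T p)) (u + 1) (v + 1) (d + 1) (- e) (- a * f)"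
proof -
  obtain h where h: "shift_expansion T u v h" "deg_le (h (- u)) d" "icoeff (h (- u)) d = e" "h v = [:f:]"
    using assms unfolding has_ends_def by blast
  note zero = shift_expansion_zero[OF h(1)]
  let ?y = "[:- of_int c, 1:] :: real poly"
  let ?H = "\<lambda>l. ?y * (h l - shift (- 1) (h (l + 1))) + smult a (h l - shift 1 (h (l - 1)))"
  have supp: "- (u + 1) \<le> l \<and> l \<le> v + 1" if "?H l \<noteq> 0" for l
  proof (rule ccontr)
    assume "\<not> (- (u + 1) \<le> l \<and> l \<le> v + 1)"
    then have "h l = 0 \<and> h (l + 1) = 0 \<and> h (l - 1) = 0" by (auto intro!: zero)
    then show False using that by simp
  qed
  have "charlier_op a c (T p) = (\<Sum>l=-(u+1)..v+1. ?H l * shift l p)" for p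
  proof -
    let ?I = "{-(u+1)..v+1}"
    have 0: "T p = (\<Sum>l\<in>?I. h l * shift l p)"
      by (rule shift_expansion_range[OF h(1)]) auto
    have 1: "shift (- 1) (T p) = (\<Sum>l\<in>?I. shift (- 1) (h (l + 1)) * shift l p)"
      using shift_expansion_shift[OF h(1), of "-(u+1)" "- 1" "v + 1" p] by simp
    have 2: "shift 1 (T p) = (\<Sum>l\<in>?I. shift 1 (h (l - 1)) * shift l p)"
      by (rule shift_expansion_shift[OF h(1)]) auto
    have "charlier_op a c (T p) =
        ?y * ((\<Sum>l\<in>?I. h l * shift l p) - (\<Sum>l\<in>?I. shift (- 1) (h (l + 1)) * shift l p)) +
        smult a ((\<Sum>l\<in>?I. h l * shift l p) - (\<Sum>l\<in>?I. shift 1 (h (l - 1)) * shift l p))"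
      unfolding charlier_op_def 1 2 0[symmetric] ..
    also have "\<dots> = (\<Sum>l\<in>?I. ?H l * shift l p)"
      unfolding sum_subtractf[symmetric] sum_distrib_left smult_sum_right sum.distrib[symmetric]
      by (intro sum.cong refl real_poly_eqI) (simp add: algebra_simps)
    finally show ?thesis .
  qed
  then have "shift_expansion (\<lambda>p. charlier_op a c (T p)) (u + 1) (v + 1) ?H"
    using supp unfolding shift_expansion_def by blast
  moreover have bottom: "?H (- (u + 1)) = smult (- 1) (?y * shift (- 1) (h (- u)))"
    using zero[of "- 1 - u"] zero[of "- u - 2"] by (simp add: algebra_simps)
  moreover have y: "deg_le ?y 1" "icoeff ?y 1 = 1"
    by (auto simp: deg_le_def icoeff_def coeff_pCons split: nat.splits)
  moreover have prod: "deg_le (?y * shift (- 1) (h (- u))) (d + 1)"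
      "icoeff (?y * shift (- 1) (h (- u))) (d + 1) = e"
    using deg_le_mult[OF y(1) deg_le_shift[OF h(2), of "- 1"]]
      icoeff_mult[OF y(1) deg_le_shift[OF h(2), of "- 1"]] icoeff_shift[OF h(2), of "- 1"] h(3) y(2)
    by (simp_all only: add.commute[of 1 d] mult_1)
  moreover have "deg_le (?H (- (u + 1))) (d + 1)"
    unfolding bottom by (rule deg_le_smult[OF prod(1)])
  moreover have "icoeff (?H (- (u + 1))) (d + 1) = - e"
    unfolding bottom icoeff_smult prod(2) by simp
  moreover have "?H (v + 1) = [:- a * f:]"
    using zero[of "v + 1"] zero[of "2 + v"] h(4) by simp
  ultimately show ?thesis
    unfolding has_ends_def by (intro exI[of _ ?H] conjI)
qed

lemma has_ends_charlier_op_funpow: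
  assumes "has_ends T u v d e f"
  shows "has_ends (\<lambda>p. (charlier_op a c ^^ i) (T p)) (u + int i) (v + int i) (d + int i) ((- 1) ^ i * e) ((- a) ^ i * f)"
proof (induction i)
  case (Suc i)
  then show ?case using has_ends_charlier_op[OF Suc, of a c] by (simp add: algebra_simps)
qed (use assms in simp)

text \<open>The terms \<open>N\<^sup>i \<S> N\<^sup>j\<close> of the subtracted part have \<open>i + j < r\<close> by the degree bound for the
  multipliers. Their lowest shift is \<open>- (i + j + 1) \<ge> - r\<close>, with a coefficient of degree at most
  \<open>i + j < r\<close>, and their highest shift is \<open>i + j - 1 < r\<close>. So they are negligible, as are the
  powers \<open>N\<^sup>i\<close> with \<open>i < r\<close> in \<open>\<Lambda>(N + m)\<close>.\<close>

lemma has_ends_cas_operator: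
  assumes W: "casoratian R m \<noteq> 0" and degW: "int (degree (casoratian R m)) = casoratian_degree g m"
    and deg: "\<And>l. l < m \<Longrightarrow> degree (R l) = g l"
    and \<Lambda>: "\<Lambda> - shift (- 1) \<Lambda> = casoratian R m" and r: "r = int (degree \<Lambda>)"
  shows "has_ends (cas_operator R m \<Lambda> (charlier_op a c)) r r r
           (lead_coeff \<Lambda> * (- 1) ^ degree \<Lambda>) (lead_coeff \<Lambda> * (- a) ^ degree \<Lambda>)"
proof -
  let ?N = "charlier_op a c"
  have r_eq: "r = casoratian_degree g m + 1" using degree_antidifference[OF \<Lambda> W] degW r by simp
  have pow: "has_ends (?N ^^ i) (int i) (int i) (int i) ((- 1) ^ i) ((- a) ^ i)" for i
    using has_ends_charlier_op_funpow[OF has_ends_id, of i a c] by (simp add: eta_contract_eq)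
  let ?P = "shift (int m) \<Lambda>"
  have lead: "coeff ?P (degree \<Lambda>) = lead_coeff \<Lambda>"
    using icoeff_shift[OF deg_le_degree[of \<Lambda>], of "int m"] by (simp add: icoeff_def)
  have "has_ends (\<lambda>p. (\<Sum>i<degree \<Lambda>. smult (coeff ?P i) ((?N ^^ i) p))) r r r 0 0"
  proof (rule has_ends_sum_zero)
    fix i assume "i \<in> {..<degree \<Lambda>}"
    then have "has_ends (?N ^^ i) r r r 0 0" using r by (intro has_ends_weaken[OF pow]) auto
    from has_ends_smult[OF this, of "coeff ?P i"]
    show "has_ends (\<lambda>p. smult (coeff ?P i) ((?N ^^ i) p)) r r r 0 0" by simp
  qed
  moreover have "has_ends (\<lambda>p. smult (coeff ?P (degree \<Lambda>)) ((?N ^^ degree \<Lambda>) p)) r r r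
      (lead_coeff \<Lambda> * (- 1) ^ degree \<Lambda>) (lead_coeff \<Lambda> * (- a) ^ degree \<Lambda>)"
    using has_ends_smult[OF pow[of "degree \<Lambda>"], of "lead_coeff \<Lambda>"] unfolding r lead .
  ultimately have main: "has_ends (op_poly ?P ?N) r r r
      (lead_coeff \<Lambda> * (- 1) ^ degree \<Lambda>) (lead_coeff \<Lambda> * (- a) ^ degree \<Lambda>)"
    using has_ends_add unfolding op_poly_def lessThan_Suc_atMost[symmetric] by fastforce
  have "has_ends (\<lambda>p. op_poly (multiplier R m l) ?N (shift (- 1) (op_poly (R l) ?N p))) r r r 0 0"
    if l: "l < m" for l
  proof -
    have eq: "op_poly (multiplier R m l) ?N (shift (- 1) (op_poly (R l) ?N p)) =
        (\<Sum>i\<le>degree (multiplier R m l). \<Sum>j\<le>degree (R l).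
          smult (coeff (multiplier R m l) i * coeff (R l) j) ((?N ^^ i) (shift (- 1) ((?N ^^ j) p))))" for p
      unfolding op_poly_def linear_op_sum[OF linear_op_shift]
        linear_op_sum[OF linear_op_funpow[OF linear_op_charlier_op]]
      by (simp add: smult_sum_right)
    show ?thesis unfolding eq
    proof (intro has_ends_sum_zero)
      fix i j assume ij: "i \<in> {..degree (multiplier R m l)}" "j \<in> {..degree (R l)}"
      show "has_ends (\<lambda>p. smult (coeff (multiplier R m l) i * coeff (R l) j)
          ((?N ^^ i) (shift (- 1) ((?N ^^ j) p)))) r r r 0 0"
      proof (cases "coeff (multiplier R m l) i = 0")
        case True
        then show ?thesis by (simp add: has_ends_zero)
      next
        case False
        have "deg_le (R l) (int (g l))" if "l < m" for l
          using deg_le_degree[of "R l"] deg[OF that] by simp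
        then have "deg_le (multiplier R m l) (casoratian_degree g m - int (g l))" by (rule multiplier_degree[OF _ l])
        then have "int i \<le> casoratian_degree g m - int (g l)"
          using False unfolding deg_le_def by (meson not_le)
        then have "int i + int j < r" using ij(2) deg[OF l] r_eq by simp
        then have "has_ends (\<lambda>p. (?N ^^ i) (shift (- 1) ((?N ^^ j) p))) r r r 0 0"
          using has_ends_charlier_op_funpow[OF has_ends_shift_down[OF pow[of j]], of i a c]
          by (elim has_ends_weaken) auto
        from has_ends_smult[OF this] show ?thesis by simp
      qed
    qed
  qed
  then have "has_ends (\<lambda>p. \<Sum>l<m. op_poly (multiplier R m l) ?N (shift (- 1) (op_poly (R l) ?N p))) r r r 0 0"
    by (intro has_ends_sum_zero) auto
  from has_ends_add[OF main has_ends_smult[OF this, of "- 1"]] show ?thesis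
    by (simp add: cas_operator_def[abs_def])
qed

section \<open>Orthogonality\<close>

lemma newton_expansion:
  assumes "deg_le S (int d)"
  obtains v where "S = (\<Sum>i\<le>d. smult (v i) (falling i))" and "v d = coeff S d" and "\<And>i. d < i \<Longrightarrow> v i = 0"
proof -
  have "\<exists>v. S = (\<Sum>i\<le>d. smult (v i) (falling i)) \<and> v d = coeff S d \<and> (\<forall>i>d. v i = 0)"
    using assms
  proof (induction d arbitrary: S)
    case 0
    then have "degree S = 0" using degree_le_of_deg_le[of S 0] by simp
    then obtain x where "S = [:x:]" by (rule degree_eq_zeroE)
    then have "S = [:coeff S 0:]" by simp
    then show ?case
      by (intro exI[of _ "\<lambda>i. if i = 0 then coeff S 0 else 0"]) simp
  next
    case (Suc d)
    let ?c = "coeff S (Suc d)"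
    have "deg_le (S - smult ?c (falling (Suc d))) (int d)"
      unfolding deg_le_def
    proof (intro allI impI)
      fix k assume "int d < int k"
      then consider "k = Suc d" | "Suc d < k" by linarith
      then show "coeff (S - smult ?c (falling (Suc d))) k = 0"
      proof cases
        case 2
        then show ?thesis using Suc.prems by (simp add: deg_le_def coeff_eq_0)
      qed simp
    qed
    then obtain v where v: "S - smult ?c (falling (Suc d)) = (\<Sum>i\<le>d. smult (v i) (falling i))"
      using Suc.IH by blast
    let ?v = "\<lambda>i. if i \<le> d then v i else if i = Suc d then ?c else 0"
    have "S = (\<Sum>i\<le>d. smult (v i) (falling i)) + smult ?c (falling (Suc d))"
      using v by (simp add: algebra_simps)
    then have "S = (\<Sum>i\<le>Suc d. smult (?v i) (falling i))" by simp
    then show ?case by (intro exI[of _ ?v]) auto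
  qed
  then show ?thesis using that by blast
qed

lemma negated_binomial_symmetry:
  "(- 1) ^ N * ((- real G - 1) gchoose N) = (- 1) ^ G * ((- real N - 1) gchoose G)"
proof -
  have "(- 1) ^ N * ((- real G - 1) gchoose N) = real ((G + N) choose N)" for G N
  proof -
    have "- real G - 1 = - (real G + 1)" by simp
    then show ?thesis
      by (simp only: gbinomial_minus left_minus_one_mult_self binomial_gbinomial) simp
  qed
  then show ?thesis using binomial_symmetric[of G "G + N"] by (simp add: add.commute)
qed

text \<open>The left-hand side is the moment of the basis element of index \<open>n - j\<close> against the falling
  factorial of degree \<open>i\<close>, up to a factor depending on \<open>i\<close> only, and it is zero for negative indices.
  The first summand on the right is its polynomial continuation in \<open>n - j\<close>, which the kernel
  vector annihilates. For degrees up to \<open>k + n\<close> the two agree except at the corner \<open>j = m\<close>,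
  \<open>i = k + n\<close>: a discrepancy needs \<open>n - j\<close> to be at most \<open>i - M - 1\<close>, and \<open>M + 1 = m + k\<close>
  leaves this one possibility. When \<open>M < i\<close> the corner comes from the moment itself, and when
  \<open>n < j\<close> from the continuation; its sign is the same.\<close>

lemma moment_comparison:
  assumes dim: "M + 1 = m + k" and i: "i \<le> k + n" and j: "j \<le> m"
  shows "(if j \<le> n then (- 1) ^ (n - j) * (of_int (int i - (int M + 1)) gchoose (n - j)) else 0 :: real) =
     (if i \<le> M then (- 1) ^ (M - i) * ((- (real n - real j) - 1) gchoose (M - i)) else 0) +
     (if j = m \<and> i = k + n then (- 1) ^ (n + m) else 0)"
proof (cases "i \<le> M"; cases "j \<le> n")
  assume *: "i \<le> M" "j \<le> n"
  then have last: "\<not> (j = m \<and> i = k + n)" using dim by auto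
  have "of_int (int i - (int M + 1)) = - real (M - i) - 1" "- (real n - real j) - 1 = - real (n - j) - 1"
    using * by (simp_all add: of_nat_diff)
  then show ?thesis
    by (simp only: if_P[OF *(1)] if_P[OF *(2)] if_not_P[OF last] negated_binomial_symmetry add_0_right)
next
  assume *: "i \<le> M" "\<not> j \<le> n"
  have eq: "- (real n - real j) - 1 = real (j - n - 1)" using * by (simp add: of_nat_diff)
  have choose: "(- (real n - real j) - 1) gchoose (M - i) = real ((j - n - 1) choose (M - i))"
    unfolding eq binomial_gbinomial ..
  show ?thesis
  proof (cases "j = m \<and> i = k + n")
    case True
    then have "j - n - 1 = M - i" using dim * by auto
    have "(- 1) ^ (n + m) = - ((- 1) ^ (M - i) :: real)"
    proof -
      have "n + m = Suc (M - i) + 2 * n" using True dim * by auto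
      then have "(- 1) ^ (n + m) = (- 1) ^ Suc (M - i) * ((- 1) ^ (2 * n) :: real)"
        by (simp only: power_add)
      then show ?thesis by (simp add: power_mult)
    qed
    moreover have "(- (real n - real j) - 1) gchoose (M - i) = 1"
      unfolding choose using \<open>j - n - 1 = M - i\<close> by simp
    ultimately show ?thesis
      by (simp only: if_not_P[OF *(2)] if_P[OF *(1)] if_P[OF True])
  next
    case False
    then have "j - n - 1 < M - i" using dim * i j by auto
    then show ?thesis using False * unfolding choose by (simp add: binomial_eq_0)
  qed
next
  assume *: "\<not> i \<le> M" "j \<le> n"
  have choose: "of_int (int i - (int M + 1)) gchoose (n - j) = real ((i - M - 1) choose (n - j))"
  proof -
    have "of_int (int i - (int M + 1)) = real (i - M - 1)" using * by (simp add: of_nat_diff)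
    then show ?thesis by (simp only: binomial_gbinomial)
  qed
  show ?thesis
  proof (cases "j = m \<and> i = k + n")
    case True
    then have "i - M - 1 = n - j" using dim * by auto
    have "(- 1) ^ (n + m) = ((- 1) ^ (n - j) :: real)"
    proof -
      have "n + m = n - j + 2 * m" using True * by auto
      then have "(- 1) ^ (n + m) = (- 1) ^ (n - j) * ((- 1) ^ (2 * m) :: real)"
        by (simp only: power_add)
      then show ?thesis by (simp add: power_mult)
    qed
    moreover have "(of_int (int i - (int M + 1)) :: real) gchoose (n - j) = 1"
      unfolding choose using \<open>i - M - 1 = n - j\<close> by simp
    ultimately show ?thesis
      by (simp only: if_not_P[OF *(1)] if_P[OF *(2)] if_P[OF True])
  next
    case False
    then have "i - M - 1 < n - j" using dim * i j by auto
    then show ?thesis using False * unfolding choose by (simp add: binomial_eq_0)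
  qed
next
  assume *: "\<not> i \<le> M" "\<not> j \<le> n"
  then have False using dim i j by auto
  then show ?thesis ..
qed

text \<open>The polynomial in \<open>n\<close> whose values at \<open>n - 1, n - 2, \<dots>\<close> are the entries of a row of \<open>\<Omega>\<^sub>F(n)\<close>.\<close>

definition casorati_row :: "real \<Rightarrow> nat \<Rightarrow> real poly" where
  "casorati_row a g = pcompose (charlier_poly (- a) g) [:- 1, - 1:]"

lemma poly_casorati_row: "poly (casorati_row a g) x = poly (charlier_poly (- a) g) (- x - 1)"
proof -
  have "poly [:- 1, - 1:] x = - x - 1" by simp
  then show ?thesis by (simp only: casorati_row_def poly_pcompose)
qed

lemma degree_casorati_row: "degree (casorati_row a g) = g"
  by (simp add: casorati_row_def degree_pcompose)

lemma casorati_row_nonzero: "casorati_row a g \<noteq> 0"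
  unfolding casorati_row_def using pcompose_eq_0[of "charlier_poly (- a) g" "[:- 1, - 1:]"] by auto

text \<open>Newton expansion of \<open>S\<close> reduces the pairing to \<open>moment_comparison\<close>. The polynomial parts lie in
  the span of the rows, as \<open>S\<close> vanishes at \<open>s\<close> unless \<open>M - s\<close> is the degree of a row, so the kernel
  relation removes them. The corner term is what is left.\<close>

lemma moment_cas_poly:
  fixes G :: "nat \<Rightarrow> nat"
  assumes dim: "M + 1 = m + k"
    and rows: "\<And>s. s \<le> M \<Longrightarrow> poly S (real s) \<noteq> 0 \<Longrightarrow> \<exists>l<m. G l = M - s"
    and S: "deg_le S (int (k + n))"
  shows "charlier_measure a (S * cas_poly (\<lambda>l. casorati_row a (G l)) m (signed_charlier a (int M + 1)) n) =
     cas_coeff (\<lambda>l. casorati_row a (G l)) m (real n) m * (- 1) ^ (n + m) * a ^ (k + n) * exp a * coeff S (k + n)"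
proof -
  let ?R = "\<lambda>l. casorati_row a (G l)"
  define b where "b = cas_coeff ?R m (real n)"
  have b0: "b j = 0" if "m < j" for j using that by (simp add: b_def cas_coeff_def)
  obtain v where v: "S = (\<Sum>i\<le>k + n. smult (v i) (falling i))" "v (k + n) = coeff S (k + n)"
      "\<And>i. k + n < i \<Longrightarrow> v i = 0"
    using newton_expansion[OF S] by blast
  define \<mu> where "\<mu> i j = (if j \<le> n then (- 1) ^ (n - j) * (of_int (int i - (int M + 1)) gchoose (n - j)) else 0 :: real)" for i j
  define \<nu> where "\<nu> i j = (- 1) ^ (M - i) * ((- (real n - real j) - 1) gchoose (M - i))" for i j
  have "S * cas_poly ?R m (signed_charlier a (int M + 1)) n =
      (\<Sum>j\<le>n. smult (b j) (\<Sum>i\<le>k + n. smult (v i) (falling i * signed_charlier a (int M + 1) (n - j))))"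
    unfolding cas_poly_def b_def[symmetric] sum_distrib_left mult_smult_right
    by (subst (1) v(1)) (simp add: sum_distrib_right)
  then have "charlier_measure a (S * cas_poly ?R m (signed_charlier a (int M + 1)) n) =
      (\<Sum>j\<le>n. b j * (\<Sum>i\<le>k + n. v i * (a ^ i * exp a * \<mu> i j)))"
    by (simp add: charlier_measure_sum charlier_measure_smult charlier_measure_falling_signed_charlier \<mu>_def mult_ac)
  \<comment> \<open>moments of negative index are zero, and so are the kernel coefficients beyond \<open>m\<close>\<close>
  also have "\<dots> = (\<Sum>j\<le>max m n. b j * (\<Sum>i\<le>k + n. v i * (a ^ i * exp a * \<mu> i j)))"
    by (intro sum.mono_neutral_left) (auto simp: \<mu>_def)
  also have "\<dots> = (\<Sum>j\<le>m. b j * (\<Sum>i\<le>k + n. v i * (a ^ i * exp a * \<mu> i j)))"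
    by (intro sum.mono_neutral_right) (auto simp: b0)
  also have "\<dots> = (\<Sum>j\<le>m. b j * (exp a * (\<Sum>i\<le>M. v i * a ^ i * \<nu> i j) +
      (if j = m then exp a * v (k + n) * a ^ (k + n) * (- 1) ^ (n + m) else 0)))"
  proof (intro sum.cong refl arg_cong2[of _ _ _ _ "(*)"])
    fix j assume "j \<in> {..m}"
    then have "v i * (a ^ i * exp a * \<mu> i j) = (if i \<le> M then exp a * (v i * a ^ i * \<nu> i j) else 0) +
        (if i = k + n then if j = m then exp a * v (k + n) * a ^ (k + n) * (- 1) ^ (n + m) else 0 else 0)"
      if "i \<le> k + n" for i
      using moment_comparison[OF dim that, of j] unfolding \<mu>_def \<nu>_def by (simp add: algebra_simps)
    then have "(\<Sum>i\<le>k + n. v i * (a ^ i * exp a * \<mu> i j)) =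
        (\<Sum>i\<le>k + n. if i \<le> M then exp a * (v i * a ^ i * \<nu> i j) else 0) +
        (if j = m then exp a * v (k + n) * a ^ (k + n) * (- 1) ^ (n + m) else 0)"
      by (simp add: sum.distrib)
    moreover have "(\<Sum>i\<le>k + n. if i \<le> M then exp a * (v i * a ^ i * \<nu> i j) else 0) =
        (\<Sum>i\<le>max (k + n) M. if i \<le> M then exp a * (v i * a ^ i * \<nu> i j) else 0)"
      by (intro sum.mono_neutral_left) (auto simp: v(3))
    moreover have "\<dots> = (\<Sum>i\<le>M. exp a * (v i * a ^ i * \<nu> i j))"
      by (intro sum.mono_neutral_cong_right) auto
    ultimately show "(\<Sum>i\<le>k + n. v i * (a ^ i * exp a * \<mu> i j)) = exp a * (\<Sum>i\<le>M. v i * a ^ i * \<nu> i j) +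
        (if j = m then exp a * v (k + n) * a ^ (k + n) * (- 1) ^ (n + m) else 0)"
      by (simp add: sum_distrib_left)
  qed
  also have "\<dots> = exp a * (\<Sum>j\<le>m. b j * (\<Sum>i\<le>M. v i * a ^ i * \<nu> i j)) +
      b m * (exp a * v (k + n) * a ^ (k + n) * (- 1) ^ (n + m))"
    by (simp add: distrib_left sum.distrib sum_distrib_left if_distrib[of "\<lambda>t. _ * t"] mult_ac cong: if_cong)
  also have "(\<Sum>j\<le>m. b j * (\<Sum>i\<le>M. v i * a ^ i * \<nu> i j)) = 0"
  proof -
    have "poly S (real s) = (\<Sum>i\<le>M. v i * poly (falling i) (real s))" if "s \<le> M" for s
    proof -
      have "poly S (real s) = (\<Sum>i\<le>k + n. v i * poly (falling i) (real s))"
        by (subst v(1)) (simp add: poly_sum)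
      also have "\<dots> = (\<Sum>i\<le>max (k + n) M. v i * poly (falling i) (real s))"
        by (intro sum.mono_neutral_left) (auto simp: v(3))
      also have "\<dots> = (\<Sum>i\<le>M. v i * poly (falling i) (real s))"
        using that by (intro sum.mono_neutral_right) (auto simp: poly_falling_small)
      finally show ?thesis .
    qed
    note span = casorati_span[OF this, of a]
    define w where "w s = poly S (real s) * a ^ s / fact s * (- 1) ^ (M - s)" for s
    from span
    have "(\<Sum>i\<le>M. v i * a ^ i * \<nu> i j) =
        (\<Sum>s\<le>M. w s * poly (casorati_row a (M - s)) (real n - real j))" for j
      unfolding \<nu>_def w_def poly_casorati_row by (simp add: mult.assoc)
    then have "(\<Sum>j\<le>m. b j * (\<Sum>i\<le>M. v i * a ^ i * \<nu> i j)) =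
        (\<Sum>s\<le>M. w s * (\<Sum>j\<le>m. b j * poly (casorati_row a (M - s)) (real n - real j)))"
      by (simp add: sum_distrib_left mult_ac) (rule sum.swap)
    also have "\<dots> = 0"
    proof (intro sum.neutral ballI)
      fix s assume "s \<in> {..M}"
      then consider "poly S (real s) = 0" | l where "l < m" "G l = M - s" using rows by auto
      then show "w s * (\<Sum>j\<le>m. b j * poly (casorati_row a (M - s)) (real n - real j)) = 0"
      proof cases
        case 2
        then show ?thesis using cas_coeff_relation[OF 2(1), of ?R "real n"] by (simp add: b_def)
      qed (simp add: w_def)
    qed
    finally show ?thesis .
  qed
  finally show ?thesis unfolding b_def v(2) by (simp add: mult_ac)
qed

lemma cas_poly_degree:
  assumes e: "\<And>n. degree (e n) = n" and e0: "e n \<noteq> 0" and W: "poly (casoratian R m) (real n) \<noteq> 0"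
  shows "degree (cas_poly R m e n) = n" and "coeff (cas_poly R m e n) n \<noteq> 0"
proof -
  have le: "degree (cas_poly R m e n) \<le> n"
    unfolding cas_poly_def by (intro degree_sum_le) (auto intro: order_trans[OF degree_smult_le] simp: e)
  have "coeff (cas_poly R m e n) n = (\<Sum>j\<in>{0}. cas_coeff R m (real n) j * coeff (e (n - j)) n)"
    unfolding cas_poly_def coeff_sum coeff_smult
    by (intro sum.mono_neutral_right) (auto simp: e intro!: coeff_eq_0)
  also have "\<dots> \<noteq> 0"
    using W e[of n] e0 leading_coeff_0_iff[of "e n"] by (simp add: cas_coeff_def)
  finally show "coeff (cas_poly R m e n) n \<noteq> 0" .
  then show "degree (cas_poly R m e n) = n" using le le_degree by (metis antisym)
qed

section \<open>Krall-Charlier polynomials\<close>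

text \<open>Adding \<open>0\<close> to the ambient interval changes nothing, since it is removed as \<open>Max F - Max F\<close>. In
  this form the removed set has as many elements as \<open>F\<close>.\<close>

lemma I_set_eq:
  assumes "finite F" and "F \<noteq> {}"
  shows "I_set F = {0..Max F} - (\<lambda>f. Max F - f) ` F"
proof -
  have "0 \<in> (\<lambda>f. Max F - f) ` F" using Max_in[OF assms] by force
  moreover have "{0..Max F} = insert 0 {1..Max F}" by auto
  ultimately show ?thesis unfolding I_set_def by auto
qed

lemma inj_on_complement: "finite F \<Longrightarrow> inj_on (\<lambda>f. Max F - f) (F :: nat set)"
  by (rule inj_onI) (metis Max_ge diff_diff_cancel)

lemma card_I_set:
  assumes "finite F" and "F \<noteq> {}"
  shows "Max F + 1 = card (I_set F) + card F"
proof -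
  have "card (I_set F) = card {0..Max F} - card ((\<lambda>f. Max F - f) ` F)"
    unfolding I_set_eq[OF assms] by (rule card_Diff_subset) (use assms in auto)
  moreover have "card ((\<lambda>f. Max F - f) ` F) \<le> card {0..Max F}"
    by (rule card_mono) auto
  ultimately show ?thesis by (simp add: card_image[OF inj_on_complement[OF assms(1)]])
qed

lemma order_F_eq:
  assumes "finite F" and "F \<noteq> {}"
  shows "order_F F = casoratian_degree (\<lambda>l. sorted_list_of_set (I_set F) ! l) (card (I_set F)) + 1"
proof -
  let ?M = "Max F" and ?k = "card F" and ?m = "card (I_set F)"
  let ?g = "sorted_list_of_set (I_set F)"
  have fin: "finite (I_set F)" by (simp add: I_set_def)
  have dim: "int ?M = int ?m + int ?k - 1" using card_I_set[OF assms] by linarith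
  have gauss: "2 * (\<Sum>i<n. int i) = int n * (int n - 1)" for n
    by (induction n) (auto simp: algebra_simps)
  have "(\<Sum>l<?m. int (?g ! l)) = (\<Sum>g\<in>I_set F. int g)"
    using sum.reindex_bij_betw[OF bij_betw_nth[of ?g "{..<?m}" "I_set F"], of int] fin by simp
  also have "\<dots> = (\<Sum>x\<in>{0..?M}. int x) - (\<Sum>x\<in>(\<lambda>f. ?M - f) ` F. int x)"
    unfolding I_set_eq[OF assms] by (rule sum_diff) auto
  also have "(\<Sum>x\<in>{0..?M}. int x) = (\<Sum>x<?m + ?k. int x)"
    using card_I_set[OF assms] by (intro sum.cong) auto
  also have "(\<Sum>x\<in>(\<lambda>f. ?M - f) ` F. int x) = (\<Sum>f\<in>F. int ?M - int f)"
    using Max_ge[OF assms(1)] by (subst sum.reindex[OF inj_on_complement[OF assms(1)]]) (auto intro!: sum.cong simp: of_nat_diff)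
  also have "\<dots> = int ?k * int ?M - (\<Sum>f\<in>F. int f)" by (simp add: sum_subtractf)
  finally have "2 * casoratian_degree ((!) ?g) ?m = int (?m + ?k) * (int (?m + ?k) - 1) - 2 * (int ?k * int ?M) + 2 * (\<Sum>f\<in>F. int f) - int ?m * (int ?m - 1)"
    using gauss[of "?m + ?k"] gauss[of ?m] by (simp add: casoratian_degree_def)
  also have "\<dots> = 2 * (\<Sum>f\<in>F. int f) - int ?k * (int ?k - 1)"
    unfolding dim by (simp add: algebra_simps)
  finally have "int ?k * (int ?k - 1) = 2 * ((\<Sum>f\<in>F. int f) - casoratian_degree ((!) ?g) ?m)" by simp
  then show ?thesis by (simp add: order_F_def)
qed

theorem corollary5p2:
  fixes a :: real and F :: "nat set"
  assumes "a \<noteq> 0"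
    and "finite F" and "F \<noteq> {}" and "\<forall>f\<in>F. f > 0"
    and "\<forall>n. Omega a F n \<noteq> 0"
  shows "\<exists>q. orthogonal_polys (rho_F a F) q \<and>
           (\<exists>h. h (- order_F F) \<noteq> 0 \<and> h (order_F F) \<noteq> 0 \<and>
                eigenfunctions (difference_operator (order_F F) h) q)"
proof -
  define M k m where "M = Max F" and "k = card F" and "m = card (I_set F)"
  define g where "g l = sorted_list_of_set (I_set F) ! l" for l
  define R where "R = (\<lambda>l. casorati_row a (g l))"
  define e where "e = signed_charlier a (int M + 1)"
  define q where "q = cas_poly R m e"
  define P where "P = (\<Prod>f\<in>F. [:- real f, 1:])"
  have fin: "finite (I_set F)" by (simp add: I_set_def)
  have g_bij: "bij_betw g {..<m} (I_set F)"
    unfolding g_def m_def using bij_betw_nth[of "sorted_list_of_set (I_set F)" "{..<card (I_set F)}" "I_set F"] fin by simp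
  have dim: "M + 1 = m + k" unfolding M_def m_def k_def by (rule card_I_set[OF assms(2,3)])
  \<comment> \<open>the maximum itself stays in \<open>I(F)\<close>, because \<open>0\<close> is not in \<open>F\<close>\<close>
  have m: "m > 0"
  proof -
    have "M \<in> F" using assms(2,3) by (simp add: M_def)
    then have "M > 0" using assms(4) by blast
    have "M \<noteq> M - f" if "f \<in> F" for f
    proof -
      have "f > 0" using assms(4) that by blast
      then show ?thesis using \<open>M > 0\<close> by simp
    qed
    then have "M \<in> I_set F" using \<open>M > 0\<close> unfolding I_set_def M_def[symmetric] by auto
    then show ?thesis using fin by (auto simp: m_def card_gt_0_iff)
  qed
  have W: "poly (casoratian R m) (real n) \<noteq> 0" for n
  proof (rule casoratian_nonzero)
    have "mat m m (\<lambda>(l, s). poly (R l) (real n - 1 - real s)) = mat m m (\<lambda>(l, j). charlier (- a) (g l) (- real n + real j))"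
      by (rule cong_mat) (auto simp: R_def poly_casorati_row poly_charlier_poly algebra_simps)
    then show "det (mat m m (\<lambda>(l, s). poly (R l) (real n - 1 - real s))) \<noteq> 0"
      using assms(5) by (simp add: Omega_def Let_def g_def m_def)
  qed
  have b: "cas_coeff R m (real n) m \<noteq> 0" for n
    using cas_coeff_last_nonzero[OF m W[of n]] W[of "Suc n"] by (simp add: add.commute)
  have e: "degree (e n) = n" "e n \<noteq> 0" for n by (auto simp: e_def signed_charlier_def)
  have deg_q: "degree (q n) = n" and lead_q: "coeff (q n) n \<noteq> 0" for n
    unfolding q_def by (rule cas_poly_degree[of e, OF e(1) e(2) W])+
  have P: "deg_le P (int k)" "coeff P k = 1"
  proof -
    have "deg_le [:- real f, 1:] 1 \<and> icoeff [:- real f, 1:] 1 = 1" for f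
      by (auto simp: deg_le_def icoeff_def coeff_pCons split: nat.splits)
    then show "deg_le P (int k)" and "coeff P k = 1"
      using deg_le_prod[of F "\<lambda>f. [:- real f, 1:]" "\<lambda>_. 1"] by (simp_all add: P_def k_def icoeff_def)
  qed
  have pairing: "rho_F a F (q n * p) =
      cas_coeff R m (real n) m * (- 1) ^ (n + m) * a ^ (k + n) * exp a * coeff p n"
    if p: "degree p \<le> n" for n p
  proof -
    have le: "deg_le P (int k)" "deg_le p (int n)"
      using P(1) deg_le_mono[OF deg_le_degree[of p]] p by auto
    have S: "deg_le (P * p) (int (k + n))" "coeff (P * p) (k + n) = coeff p n"
      using deg_le_mult[OF le] icoeff_mult[OF le] P(2) by (auto simp: icoeff_def nat_add_distrib)
    have rows: "\<exists>l<m. g l = M - s" if s: "s \<le> M" "poly (P * p) (real s) \<noteq> 0" for s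
    proof -
      have "s \<notin> F" using s(2) assms(2) by (auto simp: P_def poly_prod)
      have "M - s \<notin> (\<lambda>f. M - f) ` F"
      proof
        assume "M - s \<in> (\<lambda>f. M - f) ` F"
        then obtain f where "f \<in> F" "M - s = M - f" by auto
        moreover have "f \<le> M" using \<open>f \<in> F\<close> assms(2) by (simp add: M_def)
        ultimately show False using s(1) \<open>s \<notin> F\<close> by (metis diff_diff_cancel)
      qed
      then have "M - s \<in> I_set F" unfolding I_set_eq[OF assms(2,3)] M_def[symmetric] by auto
      then have "M - s \<in> g ` {..<m}" using g_bij by (simp add: bij_betw_def)
      then show ?thesis by auto
    qed
    have "rho_F a F (q n * p) = charlier_measure a ((P * p) * q n)"
      by (simp add: rho_F_def times_measure_def P_def mult_ac)
    then show ?thesis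
      using moment_cas_poly[OF dim rows S(1), of a] S(2) by (simp add: q_def R_def e_def)
  qed
  have "orthogonal_polys (rho_F a F) q"
    unfolding orthogonal_polys_def
  proof (intro conjI allI impI)
    fix n j :: nat
    assume "n \<noteq> j"
    have zero: "rho_F a F (q n * q j) = 0" if "j < n" for n j
      using pairing[of "q j" n] that by (simp add: deg_q coeff_eq_0)
    show "rho_F a F (q n * q j) = 0"
      using \<open>n \<noteq> j\<close> zero[of j n] zero[of n j] by (cases "j < n") (auto simp: mult.commute)
  next
    fix n
    show "rho_F a F ((q n)\<^sup>2) \<noteq> 0"
      using pairing[of "q n" n] b[of n] lead_q[of n] assms(1) by (simp add: deg_q power2_eq_square)
  qed (rule deg_q)
  moreover have "\<exists>h. h (- order_F F) \<noteq> 0 \<and> h (order_F F) \<noteq> 0 \<and> eigenfunctions (difference_operator (order_F F) h) q"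
  proof -
    obtain \<Lambda> where \<Lambda>: "\<Lambda> - shift (- 1) \<Lambda> = casoratian R m" using antidifference by blast
    have W_deg: "casoratian R m \<noteq> 0" "int (degree (casoratian R m)) = casoratian_degree g m"
      using degree_casoratian[of m R g] g_bij
      by (auto simp: R_def degree_casorati_row casorati_row_nonzero bij_betw_def)
    define D where "D = cas_operator R m \<Lambda> (charlier_op a (int M + 1))"
    have \<Lambda>_deg: "degree \<Lambda> = Suc (degree (casoratian R m))" by (rule degree_antidifference[OF \<Lambda> W_deg(1)])
    have r: "order_F F = int (degree \<Lambda>)"
      using order_F_eq[OF assms(2,3)] W_deg(2) \<Lambda>_deg by (simp add: g_def[abs_def] m_def)
    have "\<Lambda> \<noteq> 0" using \<Lambda>_deg by auto
    then have lead: "lead_coeff \<Lambda> \<noteq> 0" using leading_coeff_0_iff by blast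
    have "has_ends D (order_F F) (order_F F) (order_F F)
        (lead_coeff \<Lambda> * (- 1) ^ degree \<Lambda>) (lead_coeff \<Lambda> * (- a) ^ degree \<Lambda>)"
      unfolding D_def
      by (rule has_ends_cas_operator[OF W_deg _ \<Lambda> r]) (simp add: R_def degree_casorati_row)
    then obtain h where h: "shift_expansion D (order_F F) (order_F F) h"
        "icoeff (h (- order_F F)) (order_F F) = lead_coeff \<Lambda> * (- 1) ^ degree \<Lambda>"
        "h (order_F F) = [:lead_coeff \<Lambda> * (- a) ^ degree \<Lambda>:]"
      unfolding has_ends_def by blast
    have "h (- order_F F) \<noteq> 0" using h(2) lead by auto
    moreover have "h (order_F F) \<noteq> 0" using h(3) lead assms(1) by simp
    moreover have "difference_operator (order_F F) h (q n) = smult (poly \<Lambda> (real n)) (q n)" for n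
    proof -
      have "difference_operator (order_F F) h (q n) = D (q n)"
        using h(1) by (simp add: shift_expansion_def difference_operator_def)
      also have "\<dots> = smult (poly \<Lambda> (real n)) (q n)"
        unfolding D_def q_def e_def
        by (rule cas_operator_eigen[OF linear_op_charlier_op charlier_op_signed_charlier shift_down_signed_charlier \<Lambda>])
      finally show ?thesis .
    qed
    ultimately show ?thesis unfolding eigenfunctions_def by blast
  qed
  ultimately show ?thesis by blast
qed

end
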